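(* Assume $\mu(\Omega)<\infty$ and set $U:=L^2(\Omega)$. Suppose $\operatorname{prox}_{\tilde g/\alpha}$ is piecewise smooth in the sense of the context. Let $Y$ be a Hilbert space and let $S:L^2(\Omega)\to Y$ be a bounded linear operator whose Hilbert space adjoint $S^*$ belongs to $\mathcal L(Y,L^q(\Omega))$ for some $q>2$. Then the map $\Psi:Y\to\mathbb R$, $$\Psi(\xi)=\frac1{2\alpha}\|S^*\xi\|_U^2-\alpha\operatorname{env}_{g/\alpha}(S^*\xi/\alpha),$$ is second-order semismooth with respect to $\partial^2\Psi:Y\rightrightarrows\mathcal L(Y,Y)$ defined by $$\partial^2\Psi(\xi):=\left\{\frac1\alpha S\,\partial\operatorname{prox}_{g/\alpha}(S^*\xi/\alpha)\,S^*\right\},$$ where $\partial\operatorname{prox}_{g/\alpha}(S^*\xi/\alpha)\in L^\infty(\Omega)$ acts as a pointwise multiplication operator, i.e. the operator maps $v\in Y$ to $\frac1\alpha S\big(\partial\operatorname{prox}_{g/\alpha}(S^*\xi/\alpha)\cdot S^*v\big)$. Moreover, every element $M$ of $\partial^2\Psi(\xi)$, $\xi\in Y$, is self-adjoint and satisfies $\langle My,y\rangle\ge0$ for all $y\in Y$, and there is $c>0$ such that $\|M\|_{\mathcal L(Y,Y)}\le c$ for all $\xi\in Y$ and $M\in\partial^2\Psi(\xi)$.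
   Context: $(\Omega,\mathcal A,\mu)$ is a measure space, $\alpha>0$, $\tilde g:\mathbb R\to\mathbb R\cup\{+\infty\}$ is proper, convex and lower semicontinuous, and $g(u)=\int_\Omega\tilde g(u(x))\,d\mu$ for $u\in L^2(\Omega)$, with $g(u):=+\infty$ if $x\mapsto\tilde g(u(x))$ is not integrable. It is assumed throughout that $g$ is proper, convex, lower semicontinuous on $U=L^2(\Omega)$ with $g(0)<+\infty$. $\mathcal L(X,Z)$ denotes the bounded linear operators from $X$ to $Z$. For a proper convex lower semicontinuous function $h$ on a Hilbert space $X$, $\operatorname{env}_h(\zeta):=\min_{x\in X}\frac12\|x-\zeta\|_X^2+h(x)$ and $\operatorname{prox}_h(\zeta)$ is the unique minimizer. One has $\operatorname{prox}_{g/\alpha}(v)(x)=\operatorname{prox}_{\tilde g/\alpha}(v(x))$ a.e. The gradient of $\Psi$ is $\nabla\Psi(\xi)=S\operatorname{prox}_{g/\alpha}(S^*\xi/\alpha)$. Piecewise smooth: there are real numbers $v_1<\dots<v_N$ and continuously differentiable functions $p_k:\mathbb R\to\mathbb R$, $k=0,\dots,N$, such that $\operatorname{prox}_{\tilde g/\alpha}=p_k$ on $[v_k,v_{k+1}]$, where $v_0=-\infty$, $v_{N+1}=+\infty$ (the infinite endpoints being excluded from the intervals). Then $\partial\operatorname{prox}_{\tilde g/\alpha}(v):=p_k'(v)$ if $v\in[v_k,v_{k+1})$, and for measurable $v$ on $\Omega$, $\partial\operatorname{prox}_{g/\alpha}(v)(x):=\partial\operatorname{prox}_{\tilde g/\alpha}(v(x))$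 for $\mu$-almost all $x$. A continuously differentiable $T:Y\to\mathbb R$ is second-order semismooth with respect to a set-valued map $\partial^2T:Y\rightrightarrows\mathcal L(Y,Y)$ with non-empty images if for every $y\in Y$, as $\|h\|_Y\to0$, $\sup_{M\in\partial^2T(y+h)}|T(y+h)-T(y)-T'(y)h-\frac12\langle Mh,h\rangle|=o(\|h\|_Y^2)$ and $\sup_{M\in\partial^2T(y+h)}\|\nabla T(y+h)-\nabla T(y)-Mh\|_Y=o(\|h\|_Y)$. *)

theory Defs
  imports "HOL-Analysis.Analysis" "HOL-Probability.Essential_Supremum"
begin

section \<open>Lebesgue spaces\<close>

text \<open>
  The space \<open>L\<^sup>q(\<Omega>)\<close>, \<open>1 \<le> q \<le> \<infinity>\<close>, is handled through representatives: \<open>Lspace M q\<close> is a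
  set of functions carrying the seminorm \<open>Lnorm M q\<close>, and equality in \<open>L\<^sup>q(\<Omega>)\<close> is equality
  almost everywhere.
\<close>

definition Lspace :: "'w measure \<Rightarrow> ereal \<Rightarrow> ('w \<Rightarrow> real) set" where
  "Lspace M q = {u \<in> borel_measurable M.
     if q = \<infinity> then esssup M (\<lambda>x. ereal \<bar>u x\<bar>) < \<infinity>
     else integrable M (\<lambda>x. \<bar>u x\<bar> powr real_of_ereal q)}"

text \<open>If \<open>\<Omega>\<close> is a null set, then the essential supremum is \<open>-\<infinity>\<close>, which \<open>real_of_ereal\<close> sends to 0.\<close>

definition Lnorm :: "'w measure \<Rightarrow> ereal \<Rightarrow> ('w \<Rightarrow> real) \<Rightarrow> real" where
  "Lnorm M q u =
     (if q = \<infinity> then real_of_ereal (esssup M (\<lambda>x. ereal \<bar>u x\<bar>))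
      else (\<integral>x. \<bar>u x\<bar> powr real_of_ereal q \<partial>M) powr (1 / real_of_ereal q))"

text \<open>
  Elements of \<open>\<L>(L\<^sup>2(\<Omega>), Y)\<close>. A linear map that is bounded with respect to the seminorm takes
  the same value on functions that agree almost everywhere, so no further condition is needed.
\<close>

definition bounded_linear_from_L2 ::
  "'w measure \<Rightarrow> (('w \<Rightarrow> real) \<Rightarrow> 'y::real_normed_vector) \<Rightarrow> bool" where
  "bounded_linear_from_L2 M S \<longleftrightarrow>
     (\<forall>u\<in>Lspace M 2. \<forall>v\<in>Lspace M 2. S (\<lambda>x. u x + v x) = S u + S v) \<and>
     (\<forall>c. \<forall>u\<in>Lspace M 2. S (\<lambda>x. c * u x) = c *\<^sub>R S u) \<and>
     (\<exists>C. \<forall>u\<in>Lspace M 2. norm (S u) \<le> C * Lnorm M 2 u)"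

text \<open>Elements of \<open>\<L>(Y, L\<^sup>q(\<Omega>))\<close>, given by a choice of a representative of each value.\<close>

definition bounded_linear_into_L ::
  "'w measure \<Rightarrow> ereal \<Rightarrow> ('y::real_normed_vector \<Rightarrow> 'w \<Rightarrow> real) \<Rightarrow> bool" where
  "bounded_linear_into_L M q T \<longleftrightarrow>
     (\<forall>y. T y \<in> Lspace M q) \<and>
     (\<forall>y z. AE x in M. T (y + z) x = T y x + T z x) \<and>
     (\<forall>c y. AE x in M. T (c *\<^sub>R y) x = c * T y x) \<and>
     (\<exists>C. \<forall>y. Lnorm M q (T y) \<le> C * norm y)"

definition hilbert_adjoint_L2 ::
  "'w measure \<Rightarrow> (('w \<Rightarrow> real) \<Rightarrow> 'y::real_inner) \<Rightarrow> ('y \<Rightarrow> 'w \<Rightarrow> real) \<Rightarrow> bool" where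
  "hilbert_adjoint_L2 M S T \<longleftrightarrow>
     (\<forall>y. T y \<in> Lspace M 2) \<and>
     (\<forall>u\<in>Lspace M 2. \<forall>y. inner (S u) y = (\<integral>x. u x * T y x \<partial>M))"


section \<open>Extended-valued functions\<close>

definition proper_on :: "'a set \<Rightarrow> ('a \<Rightarrow> ereal) \<Rightarrow> bool" where
  "proper_on X h \<longleftrightarrow> (\<forall>x\<in>X. h x \<noteq> -\<infinity>) \<and> (\<exists>x\<in>X. h x \<noteq> \<infinity>)"

definition convex_ext :: "('a::real_vector \<Rightarrow> ereal) \<Rightarrow> bool" where
  "convex_ext h \<longleftrightarrow> (\<forall>x y. \<forall>t\<in>{0<..<1}.
     h ((1 - t) *\<^sub>R x + t *\<^sub>R y) \<le> ereal (1 - t) * h x + ereal t * h y)"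

definition lsc_ext :: "('a::metric_space \<Rightarrow> ereal) \<Rightarrow> bool" where
  "lsc_ext h \<longleftrightarrow> (\<forall>x X. X \<longlonglongrightarrow> x \<longrightarrow> h x \<le> liminf (\<lambda>n. h (X n)))"

definition convex_ext_L2 :: "'w measure \<Rightarrow> (('w \<Rightarrow> real) \<Rightarrow> ereal) \<Rightarrow> bool" where
  "convex_ext_L2 M h \<longleftrightarrow> (\<forall>u\<in>Lspace M 2. \<forall>v\<in>Lspace M 2. \<forall>t\<in>{0<..<1}.
     h (\<lambda>x. (1 - t) * u x + t * v x) \<le> ereal (1 - t) * h u + ereal t * h v)"

definition lsc_ext_L2 :: "'w measure \<Rightarrow> (('w \<Rightarrow> real) \<Rightarrow> ereal) \<Rightarrow> bool" where
  "lsc_ext_L2 M h \<longleftrightarrow> (\<forall>u\<in>Lspace M 2. \<forall>U. (\<forall>n. U n \<in> Lspace M 2) \<longrightarrow>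
     (\<lambda>n. Lnorm M 2 (\<lambda>x. U n x - u x)) \<longlonglongrightarrow> 0 \<longrightarrow> h u \<le> liminf (\<lambda>n. h (U n)))"

definition prox :: "('a::real_inner \<Rightarrow> ereal) \<Rightarrow> 'a \<Rightarrow> 'a" where
  "prox h \<zeta> = (THE x. is_arg_min (\<lambda>x. ereal ((norm (x - \<zeta>))\<^sup>2 / 2) + h x) (\<lambda>_. True) x)"

text \<open>
  The Moreau envelope on \<open>L\<^sup>2(\<Omega>)\<close>. For proper, convex, lower semicontinuous \<open>h\<close> the infimum
  is a finite minimum.
\<close>

definition env_L2 :: "'w measure \<Rightarrow> (('w \<Rightarrow> real) \<Rightarrow> ereal) \<Rightarrow> ('w \<Rightarrow> real) \<Rightarrow> ereal" where
  "env_L2 M h \<zeta> = (INF u\<in>Lspace M 2. ereal ((Lnorm M 2 (\<lambda>x. u x - \<zeta> x))\<^sup>2 / 2) + h u)"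

definition integral_functional ::
  "'w measure \<Rightarrow> (real \<Rightarrow> ereal) \<Rightarrow> ('w \<Rightarrow> real) \<Rightarrow> ereal" where
  "integral_functional M gt u =
     (if (AE x in M. \<bar>gt (u x)\<bar> \<noteq> \<infinity>) \<and> integrable M (\<lambda>x. real_of_ereal (gt (u x)))
      then ereal (\<integral>x. real_of_ereal (gt (u x)) \<partial>M) else \<infinity>)"


section \<open>Piecewise smooth functions\<close>

text \<open>The extended breakpoints \<open>v\<^sub>0 = -\<infinity>\<close>, \<open>v\<^sub>1, \<dots>, v\<^sub>N\<close>, \<open>v\<^bsub>N+1\<^esub> = \<infinity>\<close>.\<close>

definition breakpoint :: "nat \<Rightarrow> (nat \<Rightarrow> real) \<Rightarrow> nat \<Rightarrow> ereal" where
  "breakpoint N v k = (if k = 0 then -\<infinity> else if k \<le> N then ereal (v k) else \<infinity>)"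

definition piecewise_smooth ::
  "(real \<Rightarrow> real) \<Rightarrow> nat \<Rightarrow> (nat \<Rightarrow> real) \<Rightarrow> (nat \<Rightarrow> real \<Rightarrow> real) \<Rightarrow> bool" where
  "piecewise_smooth f N v p \<longleftrightarrow>
     strict_mono_on {1..N} v \<and>
     (\<forall>k\<le>N. p k C1_differentiable_on UNIV) \<and>
     (\<forall>k\<le>N. \<forall>t. breakpoint N v k \<le> ereal t \<and> ereal t \<le> breakpoint N v (Suc k) \<longrightarrow> f t = p k t)"

text \<open>
  The derivative of a piecewise smooth function, with the right-hand piece chosen at a
  breakpoint; the index \<open>k\<close> is determined uniquely by \<open>t\<close>.
\<close>

definition piecewise_deriv ::
  "nat \<Rightarrow> (nat \<Rightarrow> real) \<Rightarrow> (nat \<Rightarrow> real \<Rightarrow> real) \<Rightarrow> real \<Rightarrow> real" where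
  "piecewise_deriv N v p t =
     deriv (p (THE k. k \<le> N \<and> breakpoint N v k \<le> ereal t \<and> ereal t < breakpoint N v (Suc k))) t"


section \<open>Second-order semismoothness\<close>

text \<open>
  \<open>G\<close> is the gradient, so \<open>T'(y) h = \<langle>\<nabla>T(y), h\<rangle>\<close>. The suprema are taken in the extended
  reals, where they always exist, and the Landau symbols are written out.
\<close>

definition second_order_semismooth ::
  "('y::real_inner \<Rightarrow> real) \<Rightarrow> ('y \<Rightarrow> ('y \<Rightarrow>\<^sub>L 'y) set) \<Rightarrow> bool" where
  "second_order_semismooth T D2 \<longleftrightarrow>
     (\<forall>y. D2 y \<noteq> {}) \<and>
     (\<exists>G. (\<forall>y. GDERIV T y :> G y) \<and> continuous_on UNIV G \<and>
       (\<forall>y. \<forall>\<epsilon>>0. \<forall>\<^sub>F h in at 0.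
          (SUP M\<in>D2 (y + h).
             ereal \<bar>T (y + h) - T y - inner (G y) h - inner (blinfun_apply M h) h / 2\<bar>)
          \<le> ereal (\<epsilon> * (norm h)\<^sup>2)) \<and>
       (\<forall>y. \<forall>\<epsilon>>0. \<forall>\<^sub>F h in at 0.
          (SUP M\<in>D2 (y + h). ereal (norm (G (y + h) - G y - blinfun_apply M h)))
          \<le> ereal (\<epsilon> * norm h)))"


section \<open>The function and its generalized second derivative\<close>

text \<open>\<open>T\<close> stands for the adjoint of \<open>S\<close>.\<close>

definition Psi ::
  "'w measure \<Rightarrow> real \<Rightarrow> (('w \<Rightarrow> real) \<Rightarrow> ereal) \<Rightarrow> ('y \<Rightarrow> 'w \<Rightarrow> real) \<Rightarrow> 'y \<Rightarrow> real" where
  "Psi M \<alpha> g T \<xi> =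
     1 / (2 * \<alpha>) * (Lnorm M 2 (T \<xi>))\<^sup>2
     - \<alpha> * real_of_ereal (env_L2 M (\<lambda>u. g u / ereal \<alpha>) (\<lambda>x. T \<xi> x / \<alpha>))"

definition D2Psi ::
  "real \<Rightarrow> (real \<Rightarrow> real) \<Rightarrow> (('w \<Rightarrow> real) \<Rightarrow> 'y) \<Rightarrow> ('y \<Rightarrow> 'w \<Rightarrow> real)
    \<Rightarrow> 'y::real_normed_vector \<Rightarrow> ('y \<Rightarrow>\<^sub>L 'y) set" where
  "D2Psi \<alpha> dprox S T \<xi> =
     {A. \<forall>y. blinfun_apply A y = (1 / \<alpha>) *\<^sub>R S (\<lambda>x. dprox (T \<xi> x / \<alpha>) * T y x)}"

end

(*
  With h = gt / alpha, the integrand of Psi is alpha times a convex primitive of the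
  nonexpansive map prox h, evaluated at Sadj xi / alpha; hence Psi is differentiable with
  Lipschitz continuous gradient G. At each real number the right and left difference quotients
  of prox h and the values of its piecewise derivative have the same one-sided limits, so the
  first and second order remainders are pointwise k and k^2 times a bounded factor that tends
  to 0 as k -> 0. The integrability of Sadj with an exponent larger than 2 turns this into o(|h|^2) after integration.
*)

theory Submission
  imports Defs
begin

section \<open>Proximal maps on the real line\<close>

text \<open>The obstacle is a norm gap. A perturbation that is small in L^2 may be large on a small
  set, and there the bounded factor in the pointwise remainder has no reason to be small. Control of
  the adjoint in an exponent above 2 makes the contribution of such sets negligible relative to the
  squared norm of the perturbation. The generalized derivative is evaluated at the perturbed point,
  not at the base point. At a kink the left and right slopes may therefore differ: what counts is
  that the derivative along the approach has the same limit as the slope from that side. This is why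
  limits are taken one side at a time. The passage from the envelope on L^2 to an integral of scalar
  envelopes rests on the growth of the proximal map: it is at most linear, so on a finite measure
  space the pointwise minimizer is itself a square integrable competitor.\<close>

locale proper_convex_lsc =
  fixes h :: "real \<Rightarrow> ereal"
  assumes proper: "proper_on UNIV h" and convex: "convex_ext h" and lsc: "lsc_ext h"
begin

lemma finite_value: "h x \<noteq> \<infinity> \<Longrightarrow> h x = ereal (real_of_ereal (h x))"
  using proper by (cases "h x") (auto simp: proper_on_def)

lemma convex_real:
  assumes "h x = ereal a" "h y = ereal b" "0 < t" "t < 1"
  shows "h (x + t * (y - x)) \<le> ereal (a + t * (b - a))"
proof -
  have "h ((1 - t) *\<^sub>R x + t *\<^sub>R y) \<le> ereal (1 - t) * h x + ereal t * h y"
    using convex assms(3,4) unfolding convex_ext_def by auto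
  then show ?thesis
    by (simp add: assms(1,2) algebra_simps)
qed

text \<open>Lower semicontinuity keeps \<open>h\<close> above \<open>a - 1\<close> within distance
  \<open>e\<close> of a point with finite value \<open>a\<close>. By convexity, falling below the
  line of slope \<open>1 / e\<close> further out would force a value below \<open>a - 1\<close> at
  distance \<open>e\<close>. The bound makes the proximal objective coercive.\<close>

lemma linear_minorant:
  obtains x0 c d where "d \<ge> 0" "\<And>x. ereal (c - d * \<bar>x - x0\<bar>) \<le> h x"
proof -
  obtain x0 where x0: "h x0 \<noteq> \<infinity>"
    using proper unfolding proper_on_def by auto
  define a where "a = real_of_ereal (h x0)"
  have a: "h x0 = ereal a"
    using finite_value[OF x0] by (simp add: a_def)
  have "\<exists>e>0. \<forall>x. \<bar>x - x0\<bar> \<le> e \<longrightarrow> ereal (a - 1) \<le> h x"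
  proof (rule ccontr)
    assume "\<not> ?thesis"
    then have "\<forall>n. \<exists>x. \<bar>x - x0\<bar> \<le> 1 / real (Suc n) \<and> h x < ereal (a - 1)"
      by (metis not_le of_nat_0_less_iff zero_less_Suc zero_less_divide_1_iff)
    then obtain X where X: "\<And>n. \<bar>X n - x0\<bar> \<le> 1 / real (Suc n)" "\<And>n. h (X n) < ereal (a - 1)"
      by metis
    have "(\<lambda>n. X n - x0) \<longlonglongrightarrow> 0"
      by (rule Lim_null_comparison[OF _ LIMSEQ_Suc[OF lim_1_over_n]])
         (use X(1) in \<open>auto simp: eventually_sequentially\<close>)
    then have "X \<longlonglongrightarrow> x0"
      by (simp add: LIM_zero_iff)
    then have "h x0 \<le> liminf (\<lambda>n. h (X n))"
      using lsc unfolding lsc_ext_def by blast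
    also have "\<dots> \<le> liminf (\<lambda>n. ereal (a - 1))"
      by (rule Liminf_mono) (use X(2) in \<open>simp add: less_imp_le\<close>)
    also have "\<dots> = ereal (a - 1)"
      by (simp add: Liminf_const)
    finally show False by (simp add: a)
  qed
  then obtain e where e: "e > 0" "\<And>x. \<bar>x - x0\<bar> \<le> e \<Longrightarrow> ereal (a - 1) \<le> h x" by blast
  have "ereal (a - 1 - 1 / e * \<bar>x - x0\<bar>) \<le> h x" for x
  proof (cases "\<bar>x - x0\<bar> \<le> e \<or> h x = \<infinity>")
    case True
    show ?thesis
    proof (cases "h x = \<infinity>")
      case False
      then have "ereal (a - 1) \<le> h x" using True e(2) by blast
      moreover have "ereal (a - 1 - 1 / e * \<bar>x - x0\<bar>) \<le> ereal (a - 1)" using e(1) by simp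
      ultimately show ?thesis by (rule order_trans[rotated])
    qed simp
  next
    case False
    define b where "b = real_of_ereal (h x)"
    have b: "h x = ereal b"
      using False finite_value by (simp add: b_def)
    \<comment> \<open>This \<open>t\<close> puts \<open>x0 + t * (x - x0)\<close> at distance
      exactly \<open>e\<close> from \<open>x0\<close>.\<close>
    define t where "t = e / \<bar>x - x0\<bar>"
    have t: "0 < t" "t < 1" using False e(1) by (auto simp: t_def)
    have "\<bar>x0 + t * (x - x0) - x0\<bar> \<le> e"
      using False e(1) by (auto simp: t_def abs_mult)
    then have "ereal (a - 1) \<le> h (x0 + t * (x - x0))"
      using e(2) by blast
    also have "\<dots> \<le> ereal (a + t * (b - a))"
      using convex_real[OF a b t] .
    finally have "- 1 \<le> t * (b - a)" by simp
    then have "- (1 / t) \<le> b - a"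
      using t(1) by (simp add: field_simps)
    moreover have "1 / t = 1 / e * \<bar>x - x0\<bar>" by (simp add: t_def)
    ultimately show ?thesis by (simp add: b)
  qed
  with e(1) show ?thesis
    by (intro that[of "1 / e" "a - 1" x0]) auto
qed

section \<open>Existence, uniqueness and nonexpansiveness of the proximal point\<close>

definition is_prox :: "real \<Rightarrow> real \<Rightarrow> bool" where
  "is_prox z x \<longleftrightarrow> is_arg_min (\<lambda>x. ereal ((norm (x - z))\<^sup>2 / 2) + h x) (\<lambda>_. True) x"

lemma is_prox_iff:
  "is_prox z x \<longleftrightarrow> (\<forall>y. ereal ((x - z)\<^sup>2 / 2) + h x \<le> ereal ((y - z)\<^sup>2 / 2) + h y)"
  by (auto simp: is_prox_def is_arg_min_def not_less)

lemma is_prox_finite: "is_prox z x \<Longrightarrow> h x \<noteq> \<infinity>"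
proof
  assume "is_prox z x" "h x = \<infinity>"
  then have "\<infinity> \<le> ereal ((y - z)\<^sup>2 / 2) + h y" for y
    unfolding is_prox_iff by (metis plus_ereal.simps(2) add.commute)
  then have "h y = \<infinity>" for y
    by (metis PInfty_neq_ereal(1) ereal_infty_less_eq(1) ereal_plus_eq_PInfty)
  then show False using proper by (auto simp: proper_on_def)
qed

text \<open>Compare \<open>x\<close> with the nearby competitor \<open>x + t * (y - x)\<close>:
  convexity bounds its objective, and division by \<open>t\<close> followed by \<open>t\<close>
  tending to 0 removes the quadratic term. The outcome says that \<open>z - x\<close> is a
  subgradient of \<open>h\<close> at \<open>x\<close>.\<close>

lemma is_prox_variational:
  assumes "is_prox z x" "h x = ereal a" "h y = ereal b"
  shows "a + (z - x) * (y - x) \<le> b"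
proof -
  have *: "0 \<le> (x - z) * (y - x) + t * (y - x)\<^sup>2 / 2 + (b - a)" if t: "0 < t" "t < 1" for t
  proof -
    have "ereal ((x - z)\<^sup>2 / 2) + h x \<le> ereal ((x + t * (y - x) - z)\<^sup>2 / 2) + h (x + t * (y - x))"
      using assms(1) by (simp add: is_prox_iff)
    also have "\<dots> \<le> ereal ((x + t * (y - x) - z)\<^sup>2 / 2) + ereal (a + t * (b - a))"
      by (rule add_left_mono[OF convex_real[OF assms(2,3) t]])
    finally have "(x - z)\<^sup>2 / 2 + a \<le> (x + t * (y - x) - z)\<^sup>2 / 2 + (a + t * (b - a))"
      by (simp add: assms(2))
    moreover have "(x + t * (y - x) - z)\<^sup>2 / 2 + (a + t * (b - a)) - ((x - z)\<^sup>2 / 2 + a)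
        = t * ((x - z) * (y - x) + t * (y - x)\<^sup>2 / 2 + (b - a))"
      by (simp add: field_simps power2_eq_square)
    ultimately have "0 \<le> t * ((x - z) * (y - x) + t * (y - x)\<^sup>2 / 2 + (b - a))"
      by linarith
    then show ?thesis using t(1) by (simp add: zero_le_mult_iff)
  qed
  have "((\<lambda>t. (x - z) * (y - x) + t * (y - x)\<^sup>2 / 2 + (b - a)) \<longlongrightarrow>
      (x - z) * (y - x) + 0 * (y - x)\<^sup>2 / 2 + (b - a)) (at_right 0)"
    by (intro tendsto_intros) auto
  moreover have "\<forall>\<^sub>F t in at_right 0. 0 \<le> (x - z) * (y - x) + t * (y - x)\<^sup>2 / 2 + (b - a)"
    using * by (auto simp: eventually_at_right_field intro!: exI[of _ 1])
  ultimately have "0 \<le> (x - z) * (y - x) + 0 * (y - x)\<^sup>2 / 2 + (b - a)"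
    using tendsto_lowerbound trivial_limit_at_right_real by blast
  then show ?thesis by (simp add: algebra_simps)
qed

text \<open>Adding the variational inequality at \<open>x\<close> tested with \<open>y\<close> and
  the one at \<open>y\<close> tested with \<open>x\<close> cancels the values of
  \<open>h\<close>.\<close>

lemma is_prox_firmly_nonexpansive:
  assumes "is_prox z x" "is_prox w y"
  shows "(y - x)\<^sup>2 \<le> (w - z) * (y - x)"
proof -
  obtain a b where ab: "h x = ereal a" "h y = ereal b"
    using finite_value is_prox_finite assms by metis
  show ?thesis
    using is_prox_variational[OF assms(1) ab] is_prox_variational[OF assms(2) ab(2,1)]
    by (simp add: algebra_simps power2_eq_square)
qed

text \<open>The direct method: coercivity bounds a minimizing sequence, a subsequence converges, and
  lower semicontinuity makes its limit a minimizer.\<close>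

lemma ex_is_prox: "\<exists>x. is_prox z x"
proof -
  define F where "F x = ereal ((x - z)\<^sup>2 / 2) + h x" for x
  obtain x0 c d where minorant: "d \<ge> 0" "\<And>x. ereal (c - d * \<bar>x - x0\<bar>) \<le> h x"
    by (rule linear_minorant) (rule that)
  \<comment> \<open>Completing the square absorbs the linear minorant into one half of the quadratic
    term; the other half, \<open>(x - z)^2 / 4\<close>, remains to bound minimizing
    sequences.\<close>
  have F_ge: "ereal ((\<bar>x - z\<bar> - 2 * d)\<^sup>2 / 4 + (c - d * \<bar>z - x0\<bar> - d\<^sup>2) + (x - z)\<^sup>2 / 4) \<le> F x" for x
  proof -
    have "d * \<bar>x - x0\<bar> \<le> d * (\<bar>x - z\<bar> + \<bar>z - x0\<bar>)"
      using minorant(1) by (intro mult_left_mono) linarith+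
    moreover have "(u - 2 * d)\<^sup>2 / 4 + (c - d * w - d\<^sup>2) + u\<^sup>2 / 4 \<le> u\<^sup>2 / 2 + (c - D)"
      if "D \<le> d * (u + w)" for u w D :: real
      using that by (simp add: field_simps power2_eq_square)
    ultimately have "(\<bar>x - z\<bar> - 2 * d)\<^sup>2 / 4 + (c - d * \<bar>z - x0\<bar> - d\<^sup>2) + \<bar>x - z\<bar>\<^sup>2 / 4
        \<le> \<bar>x - z\<bar>\<^sup>2 / 2 + (c - d * \<bar>x - x0\<bar>)"
      by blast
    then have "ereal ((\<bar>x - z\<bar> - 2 * d)\<^sup>2 / 4 + (c - d * \<bar>z - x0\<bar> - d\<^sup>2) + (x - z)\<^sup>2 / 4)
        \<le> ereal ((x - z)\<^sup>2 / 2) + ereal (c - d * \<bar>x - x0\<bar>)"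
      unfolding power2_abs plus_ereal.simps ereal_less_eq .
    also have "\<dots> \<le> F x"
      unfolding F_def by (rule add_left_mono[OF minorant(2)])
    finally show ?thesis .
  qed
  define l where "l = c - d * \<bar>z - x0\<bar> - d\<^sup>2"
  have F_ge': "ereal (l + (x - z)\<^sup>2 / 4) \<le> F x" for x
    by (rule order_trans[OF _ F_ge]) (simp add: l_def)
  define m where "m = (INF x. F x)"
  have "ereal l \<le> m"
    unfolding m_def by (intro INF_greatest order_trans[OF _ F_ge']) simp
  obtain y where "h y \<noteq> \<infinity>" using proper by (auto simp: proper_on_def)
  then have "F y \<noteq> \<infinity>" by (simp add: F_def)
  then have "m \<noteq> \<infinity>" unfolding m_def by (metis INF_lower UNIV_I ereal_infty_less_eq(1))
  with \<open>ereal l \<le> m\<close> obtain r where r: "m = ereal r" by (cases m) auto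
  have "\<exists>x. F x < ereal (r + 1 / real (Suc n))" for n
  proof -
    have "m < ereal (r + 1 / real (Suc n))" by (simp add: r)
    then show ?thesis unfolding m_def by (auto simp: INF_less_iff)
  qed
  then obtain X where X: "\<And>n. F (X n) < ereal (r + 1 / real (Suc n))" by metis
  have "\<bar>X n - z\<bar> \<le> 1 + 4 * (r + 1 - l)" for n
  proof -
    have "ereal (l + (X n - z)\<^sup>2 / 4) < ereal (r + 1 / real (Suc n))"
      using F_ge' X le_less_trans by blast
    then have "(X n - z)\<^sup>2 \<le> 4 * (r + 1 / real (Suc n) - l)" by simp
    also have "\<dots> \<le> 4 * (r + 1 - l)" by (simp add: divide_le_eq)
    finally have *: "(X n - z)\<^sup>2 \<le> 4 * (r + 1 - l)" .
    \<comment> \<open>A crude bound that avoids square roots; it comes from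
      \<open>0 \<le> (u - 1)^2\<close>.\<close>
    have "\<bar>X n - z\<bar> \<le> 1 + (X n - z)\<^sup>2"
    proof -
      have "u \<le> 1 + u\<^sup>2" if "0 \<le> u" for u :: real
        using that zero_le_power2[of "u - 1"] unfolding power2_diff by simp
      from this[of "\<bar>X n - z\<bar>"] show ?thesis by simp
    qed
    with * show ?thesis by linarith
  qed
  then have "norm (X n) \<le> \<bar>z\<bar> + (1 + 4 * (r + 1 - l))" for n
    using abs_triangle_ineq[of z "X n - z"] by (metis add_left_mono diff_add_cancel add.commute order_trans real_norm_def)
  then have "bounded (range X)"
    unfolding bounded_iff by blast
  then obtain x s where s: "strict_mono s" "(X \<circ> s) \<longlonglongrightarrow> x"
    using bounded_imp_convergent_subsequence by blast
  have "h x \<le> liminf (\<lambda>n. h ((X \<circ> s) n))"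
    using lsc s(2) unfolding lsc_ext_def by blast
  \<comment> \<open>Lower semicontinuity concerns \<open>h\<close> alone, so the convergent
    quadratic part is moved to the other side before the limit is taken.\<close>
  also have "\<dots> \<le> liminf (\<lambda>n. ereal (r + 1 / real (Suc (s n)) - (X (s n) - z)\<^sup>2 / 2))"
  proof (rule Liminf_mono, rule always_eventually, rule allI)
    fix n show "h ((X \<circ> s) n) \<le> ereal (r + 1 / real (Suc (s n)) - (X (s n) - z)\<^sup>2 / 2)"
      using X[of "s n"] unfolding F_def by (cases "h (X (s n))") auto
  qed
  also have "\<dots> = ereal (r + 0 - (x - z)\<^sup>2 / 2)"
  proof (rule lim_imp_Liminf, simp)
    have "(\<lambda>n. 1 / real (Suc (s n))) \<longlonglongrightarrow> 0"
      using LIMSEQ_subseq_LIMSEQ[OF LIMSEQ_Suc[OF lim_1_over_n] s(1)] by (simp add: o_def)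
    then show "(\<lambda>n. ereal (r + 1 / real (Suc (s n)) - (X (s n) - z)\<^sup>2 / 2))
        \<longlonglongrightarrow> ereal (r + 0 - (x - z)\<^sup>2 / 2)"
      using s(2) unfolding o_def by (intro tendsto_ereal tendsto_intros) auto
  qed
  finally have "F x \<le> m" by (cases "h x") (auto simp: r F_def)
  then have "F x \<le> F y" for y
    unfolding m_def by (meson INF_lower UNIV_I order_trans)
  then show ?thesis unfolding is_prox_iff F_def by blast
qed

text \<open>Firm nonexpansiveness with both arguments equal to \<open>z\<close> forces any two
  minimizers to coincide, so the definite description in \<open>prox\<close> is meaningful.\<close>

lemma prox_is_prox: "is_prox z (prox h z)"
proof -
  have "\<exists>!x. is_prox z x"
    using ex_is_prox is_prox_firmly_nonexpansive[of z _ z] by force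
  then have "is_prox z (THE x. is_prox z x)" by (rule theI')
  then show ?thesis by (simp add: prox_def is_prox_def)
qed

lemma prox_firmly_nonexpansive: "(prox h b - prox h a)\<^sup>2 \<le> (b - a) * (prox h b - prox h a)"
  using is_prox_firmly_nonexpansive prox_is_prox by blast

lemma prox_nonexpansive: "\<bar>prox h b - prox h a\<bar> \<le> \<bar>b - a\<bar>"
proof (cases "prox h b = prox h a")
  case False
  have "\<bar>prox h b - prox h a\<bar> * \<bar>prox h b - prox h a\<bar> = (prox h b - prox h a)\<^sup>2"
    by (simp add: power2_eq_square)
  also have "\<dots> \<le> (b - a) * (prox h b - prox h a)"
    by (rule prox_firmly_nonexpansive)
  also have "\<dots> \<le> \<bar>b - a\<bar> * \<bar>prox h b - prox h a\<bar>"
    by (metis abs_ge_self abs_mult)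
  finally show ?thesis
    by (rule mult_right_le_imp_le) (use False in simp)
qed simp

text \<open>Monotonicity and nonexpansiveness as bounds on quotients, the form that passes to the
  limit in the bounds on the piecewise derivative. For \<open>a = b\<close> the quotient is 0 by
  convention.\<close>

lemma prox_slope: "0 \<le> (prox h b - prox h a) / (b - a)" "(prox h b - prox h a) / (b - a) \<le> 1"
proof -
  have "0 \<le> (b - a) * (prox h b - prox h a)"
    using prox_firmly_nonexpansive[of b a] zero_le_power2 order_trans by blast
  then show "0 \<le> (prox h b - prox h a) / (b - a)"
    by (auto simp: zero_le_divide_iff zero_le_mult_iff)
  have "\<bar>(prox h b - prox h a) / (b - a)\<bar> \<le> 1"
    using prox_nonexpansive[of b a] by (simp add: abs_divide divide_le_eq)
  then show "(prox h b - prox h a) / (b - a) \<le> 1" by linarith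
qed

lemma isCont_prox: "isCont (prox h) x"
  unfolding isCont_def by (rule LIM_zero_cancel, rule Lim_null_comparison[where g="\<lambda>y. \<bar>y - x\<bar>"])
    (auto intro!: tendsto_eq_intros always_eventually prox_nonexpansive)

lemma borel_measurable_prox [measurable]: "prox h \<in> borel_measurable borel"
  by (intro borel_measurable_continuous_onI continuous_at_imp_continuous_on ballI isCont_prox)

section \<open>The real-valued Moreau envelope and a primitive of the proximal map\<close>

definition envelope :: "real \<Rightarrow> real" where
  "envelope z = (prox h z - z)\<^sup>2 / 2 + real_of_ereal (h (prox h z))"

lemma prox_finite: "h (prox h z) = ereal (real_of_ereal (h (prox h z)))"
  using finite_value is_prox_finite prox_is_prox by blast

text \<open>Minimality of the proximal point, transferred to the reals. Infinite values have to be
  excluded because \<open>real_of_ereal\<close> would turn them into 0.\<close>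

lemma envelope_le:
  assumes "\<bar>h y\<bar> \<noteq> \<infinity>"
  shows "envelope z \<le> (y - z)\<^sup>2 / 2 + real_of_ereal (h y)"
proof -
  have "ereal ((prox h z - z)\<^sup>2 / 2) + h (prox h z) \<le> ereal ((y - z)\<^sup>2 / 2) + h y"
    using prox_is_prox[of z] unfolding is_prox_iff by blast
  moreover have "h y = ereal (real_of_ereal (h y))"
    using assms by (simp add: ereal_real)
  ultimately have "ereal ((prox h z - z)\<^sup>2 / 2) + ereal (real_of_ereal (h (prox h z)))
      \<le> ereal ((y - z)\<^sup>2 / 2) + ereal (real_of_ereal (h y))"
    using prox_finite[of z] by metis
  then show ?thesis by (simp add: envelope_def)
qed

text \<open>The conjugate of \<open>s \<mapsto> s\<^sup>2 / 2 + h s\<close>, a primitive of the proximal map.\<close>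

definition potential :: "real \<Rightarrow> real" where
  "potential z = z\<^sup>2 / 2 - envelope z"

text \<open>The point \<open>prox h a\<close> is a competitor in the minimization behind
  \<open>envelope b\<close>. After expansion of the squares this leaves the affine function that
  touches \<open>potential\<close> at \<open>a\<close>.\<close>

lemma potential_subgradient: "potential a + prox h a * (b - a) \<le> potential b"
proof -
  have "\<bar>h (prox h a)\<bar> \<noteq> \<infinity>"
    by (subst prox_finite) simp
  note envelope_le[OF this, of b]
  moreover have "potential a + prox h a * (b - a)
      = b\<^sup>2 / 2 - ((prox h a - b)\<^sup>2 / 2 + real_of_ereal (h (prox h a)))"
    unfolding potential_def envelope_def by (simp add: field_simps power2_eq_square)
  ultimately show ?thesis
    unfolding potential_def[of b] by linarith
qed

text \<open>The subgradient at \<open>a\<close> makes the remainder nonnegative; the one at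
  \<open>b\<close> bounds it by \<open>(prox h b - prox h a) * (b - a)\<close>, to which
  nonexpansiveness applies. The estimate is uniform in \<open>a\<close>, so it can be integrated
  later.\<close>

lemma potential_remainder: "\<bar>potential b - potential a - prox h a * (b - a)\<bar> \<le> (b - a)\<^sup>2"
proof -
  have "(prox h b - prox h a) * (b - a) \<le> \<bar>prox h b - prox h a\<bar> * \<bar>b - a\<bar>"
    by (metis abs_ge_self abs_mult)
  also have "\<dots> \<le> \<bar>b - a\<bar> * \<bar>b - a\<bar>"
    by (intro mult_right_mono prox_nonexpansive) auto
  also have "\<dots> = (b - a)\<^sup>2" by (simp add: power2_eq_square)
  finally show ?thesis
    using potential_subgradient[of a b] potential_subgradient[of b a] by (simp add: algebra_simps)
qed

lemma potential_has_derivative: "(potential has_real_derivative prox h x) (at x)"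
  unfolding DERIV_def
proof (rule LIM_zero_cancel, rule Lim_null_comparison[where g="\<lambda>k. \<bar>k\<bar>"])
  show "\<forall>\<^sub>F k in at 0. norm ((potential (x + k) - potential x) / k - prox h x) \<le> \<bar>k\<bar>"
  proof (rule eventually_mono[OF eventually_neq_at_within[of 0]])
    fix k :: real assume "k \<noteq> 0"
    then have "norm ((potential (x + k) - potential x) / k - prox h x)
        = \<bar>potential (x + k) - potential x - prox h x * k\<bar> / \<bar>k\<bar>"
      by (simp add: abs_divide[symmetric] diff_divide_distrib)
    also have "\<dots> \<le> k\<^sup>2 / \<bar>k\<bar>"
      using potential_remainder[of "x + k" x] by (intro divide_right_mono) auto
    also have "\<dots> = \<bar>k\<bar>" by (metis abs_mult_self_eq nonzero_mult_div_cancel_right \<open>k \<noteq> 0\<close> abs_eq_0 power2_eq_square)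
    finally show "norm ((potential (x + k) - potential x) / k - prox h x) \<le> \<bar>k\<bar>" .
  qed
qed (auto intro!: tendsto_eq_intros)

lemma borel_measurable_potential [measurable]: "potential \<in> borel_measurable borel"
  by (intro borel_measurable_continuous_onI continuous_at_imp_continuous_on ballI
      DERIV_isCont[OF potential_has_derivative])

end

section \<open>Piecewise smooth functions\<close>

lemma breakpoint_mono:
  assumes "strict_mono_on {1..N} v" "j \<le> k"
  shows "breakpoint N v j \<le> breakpoint N v k"
proof -
  have "mono_on {1..N} v" using assms(1) by (rule strict_mono_on_imp_mono_on)
  then show ?thesis
    using assms(2) by (auto simp: breakpoint_def mono_on_def)
qed

lemma ex_breakpoint_interval:
  "\<exists>k\<le>N. breakpoint N v k \<le> ereal t \<and> ereal t < breakpoint N v (Suc k)"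
proof -
  define K where "K = {k. k \<le> N \<and> breakpoint N v k \<le> ereal t}"
  have "finite K" "0 \<in> K" by (auto simp: K_def breakpoint_def)
  then have "Max K \<in> K" by (intro Max_in) auto
  moreover have "Suc (Max K) \<notin> K"
    using \<open>finite K\<close> Max_ge Suc_n_not_le_n by blast
  ultimately obtain k where k: "k \<in> K" "Suc k \<notin> K" by blast
  \<comment> \<open>\<open>Suc k\<close> leaves \<open>K\<close> for one of two reasons: it exceeds
    \<open>N\<close>, where the next breakpoint is infinite, or its breakpoint lies beyond
    \<open>t\<close>.\<close>
  show ?thesis
  proof (cases "k = N")
    case True
    with k show ?thesis by (auto simp: K_def breakpoint_def intro!: exI[of _ N])
  next
    case False
    with k show ?thesis by (auto simp: K_def not_le intro!: exI[of _ k])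
  qed
qed

text \<open>Intervals closed on the right select the piece that is valid to the left of
  \<open>t\<close>, whereas \<open>piecewise_deriv\<close> selects the piece on its right. The two
  differ only at breakpoints.\<close>

lemma ex_breakpoint_interval_left:
  "\<exists>k\<le>N. breakpoint N v k < ereal t \<and> ereal t \<le> breakpoint N v (Suc k)"
proof -
  define K where "K = {k. k \<le> N \<and> breakpoint N v k < ereal t}"
  have "finite K" "0 \<in> K" by (auto simp: K_def breakpoint_def)
  then have "Max K \<in> K" by (intro Max_in) auto
  moreover have "Suc (Max K) \<notin> K"
    using \<open>finite K\<close> Max_ge Suc_n_not_le_n by blast
  ultimately obtain k where k: "k \<in> K" "Suc k \<notin> K" by blast
  show ?thesis
  proof (cases "k = N")
    case True
    with k show ?thesis by (auto simp: K_def breakpoint_def intro!: exI[of _ N])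
  next
    case False
    with k show ?thesis by (auto simp: K_def not_less intro!: exI[of _ k])
  qed
qed

text \<open>For \<open>j < k\<close> one has \<open>Suc j \<le> k\<close>, so interval
  \<open>j\<close> ends no later than interval \<open>k\<close> starts; hence \<open>t\<close>
  determines its index.\<close>

lemma piecewise_deriv_eq:
  assumes "strict_mono_on {1..N} v" "k \<le> N"
    and "breakpoint N v k \<le> ereal t" "ereal t < breakpoint N v (Suc k)"
  shows "piecewise_deriv N v p t = deriv (p k) t"
proof -
  have "(THE k. k \<le> N \<and> breakpoint N v k \<le> ereal t \<and> ereal t < breakpoint N v (Suc k)) = k"
  proof (rule the_equality)
    fix j assume "j \<le> N \<and> breakpoint N v j \<le> ereal t \<and> ereal t < breakpoint N v (Suc j)"
    then show "j = k"
      using breakpoint_mono[OF assms(1), of "Suc j" k] breakpoint_mono[OF assms(1), of "Suc k" j]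
        assms(3,4) by (metis Suc_leI linorder_neqE_nat not_le order_trans)
  qed (use assms in auto)
  then show ?thesis by (simp add: piecewise_deriv_def)
qed

lemma eventually_at_right_less_ereal:
  assumes "ereal t < b" shows "\<forall>\<^sub>F s in at_right t. ereal s < b"
proof -
  have "((\<lambda>s. ereal s) \<longlongrightarrow> ereal t) (at_right t)" by (intro tendsto_intros)
  then show ?thesis using assms by (rule order_tendstoD)
qed

lemma eventually_at_left_greater_ereal:
  assumes "a < ereal t" shows "\<forall>\<^sub>F s in at_left t. a < ereal s"
proof -
  have "((\<lambda>s. ereal s) \<longlongrightarrow> ereal t) (at_left t)" by (intro tendsto_intros)
  then show ?thesis using assms by (rule order_tendstoD)
qed

lemma C1_deriv:
  assumes "f C1_differentiable_on UNIV"
  shows "(f has_real_derivative deriv f x) (at x)" "isCont (deriv f) x"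
proof -
  obtain D where D: "\<And>x. (f has_real_derivative D x) (at x)" "continuous_on UNIV D"
    using assms unfolding C1_differentiable_on_def
    by (auto simp: has_real_derivative_iff_has_vector_derivative)
  then have "deriv f = D" by (auto intro: DERIV_imp_deriv)
  then show "(f has_real_derivative deriv f x) (at x)" "isCont (deriv f) x"
    using D by (auto simp: continuous_on_eq_continuous_at)
qed

section \<open>Remainder quotients along a restricted approach\<close>

lemma tendsto_slope_within:
  fixes f :: "real \<Rightarrow> real"
  assumes "(f has_real_derivative D) (at t)"
  shows "((\<lambda>s. (f s - f t) / (s - t)) \<longlongrightarrow> D) (at t within A)"
  using has_field_derivative_at_within[OF assms] by (simp add: has_field_derivative_iff)

text \<open>Away from \<open>t\<close> the quotient is the slope minus \<open>d s\<close>, and both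
  tend to \<open>D\<close>. Since \<open>d\<close> is taken at the moving point, only its limit
  matters, not its value at \<open>t\<close>.\<close>

lemma semismooth_quotient:
  fixes f d :: "real \<Rightarrow> real"
  assumes "((\<lambda>s. (f s - f t) / (s - t)) \<longlongrightarrow> D) (at t within A)" "(d \<longlongrightarrow> D) (at t within A)"
  shows "((\<lambda>s. (f s - f t - d s * (s - t)) / (s - t)) \<longlongrightarrow> 0) (at t within A)"
proof -
  have "((\<lambda>s. (f s - f t) / (s - t) - d s) \<longlongrightarrow> D - D) (at t within A)"
    by (intro tendsto_diff assms)
  then show ?thesis
    by (simp, elim Lim_transform_eventually)
       (auto simp: eventually_at_filter diff_divide_distrib)
qed

text \<open>The Taylor remainder \<open>R\<close> with the fixed coefficient \<open>D\<close> has
  derivative of order \<open>o(s - t)\<close>, so the mean value theorem gives second order for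
  \<open>R\<close>. The condition on \<open>A\<close> keeps the intermediate point on the side where
  the slopes are controlled.\<close>

lemma second_order_quotient:
  fixes F f d :: "real \<Rightarrow> real"
  assumes F: "\<And>s. (F has_real_derivative f s) (at s)"
    and A: "\<And>s r. s \<in> A \<Longrightarrow> r \<in> open_segment t s \<Longrightarrow> r \<in> A"
    and f: "((\<lambda>s. (f s - f t) / (s - t)) \<longlongrightarrow> D) (at t within A)" and d: "(d \<longlongrightarrow> D) (at t within A)"
  shows "((\<lambda>s. (F s - F t - f t * (s - t) - d s * (s - t)\<^sup>2 / 2) / (s - t)\<^sup>2) \<longlongrightarrow> 0) (at t within A)"
proof -
  define R where "R s = F s - F t - f t * (s - t) - D * (s - t)\<^sup>2 / 2" for s
  have R': "(R has_real_derivative f s - f t - D * (s - t)) (at s)" for s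
    unfolding R_def by (auto intro!: derivative_eq_intros F)
  have "((\<lambda>s. R s / (s - t)\<^sup>2) \<longlongrightarrow> 0) (at t within A)"
  proof (rule tendstoI)
    fix e :: real assume "e > 0"
    have "\<forall>\<^sub>F s in at t within A. dist ((f s - f t) / (s - t)) D < e"
      using f \<open>e > 0\<close> by (rule tendstoD)
    then obtain b where b: "b > 0"
      "\<And>s. s \<in> A \<Longrightarrow> s \<noteq> t \<Longrightarrow> dist s t < b \<Longrightarrow> dist ((f s - f t) / (s - t)) D < e"
      unfolding eventually_at by blast
    have "dist (R s / (s - t)\<^sup>2) 0 < e" if s: "s \<in> A" "s \<noteq> t" "dist s t < b" for s
    proof -
      obtain r where r: "r \<in> open_segment t s" "R s - R t = (s - t) * (f r - f t - D * (r - t))"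
      proof (cases "t < s")
        case True
        then obtain r where "t < r" "r < s" "R s - R t = (s - t) * (f r - f t - D * (r - t))"
          using MVT2[OF True R'] by blast
        then show thesis using that True by (auto simp: open_segment_eq_real_ivl)
      next
        case False
        then have "s < t" using s by auto
        then obtain r where "s < r" "r < t" "R t - R s = (t - s) * (f r - f t - D * (r - t))"
          using MVT2[OF \<open>s < t\<close> R'] by blast
        then show thesis using that[of r] \<open>s < t\<close> by (auto simp: open_segment_eq_real_ivl algebra_simps)
      qed
      have r': "r \<noteq> t" "\<bar>r - t\<bar> \<le> \<bar>s - t\<bar>"
        using r(1) s(2) by (auto simp: open_segment_eq_real_ivl split: if_splits)
      have "dist ((f r - f t) / (r - t)) D < e"
        using b(2)[of r] A[OF s(1) r(1)] r' s(3) by (auto simp: dist_real_def)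
      then have "\<bar>((f r - f t) / (r - t) - D) * (r - t)\<bar> < e * \<bar>r - t\<bar>"
        using r'(1) by (simp add: abs_mult dist_real_def)
      also have "((f r - f t) / (r - t) - D) * (r - t) = f r - f t - D * (r - t)"
        using r'(1) by (simp add: field_simps)
      also have "e * \<bar>r - t\<bar> \<le> e * \<bar>s - t\<bar>" using r'(2) \<open>e > 0\<close> by simp
      finally have "\<bar>s - t\<bar> * \<bar>f r - f t - D * (r - t)\<bar> < \<bar>s - t\<bar> * (e * \<bar>s - t\<bar>)"
        using s(2) by (intro mult_strict_left_mono) auto
      also have "\<bar>s - t\<bar> * (e * \<bar>s - t\<bar>) = e * (s - t)\<^sup>2"
        by (simp add: power2_eq_square)
      also have "\<bar>s - t\<bar> * \<bar>f r - f t - D * (r - t)\<bar> = \<bar>R s\<bar>"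
        using r(2) by (simp add: R_def abs_mult)
      finally show ?thesis using s(2) by (simp add: abs_divide divide_less_eq)
    qed
    then show "\<forall>\<^sub>F s in at t within A. dist (R s / (s - t)\<^sup>2) 0 < e"
      unfolding eventually_at using b(1) by blast
  qed
  \<comment> \<open>The cost of replacing the fixed coefficient \<open>D\<close> by the moving one
    \<open>d s\<close>.\<close>
  moreover have "((\<lambda>s. (D - d s) / 2) \<longlongrightarrow> (D - D) / 2) (at t within A)"
    by (intro tendsto_intros d) simp
  ultimately have "((\<lambda>s. R s / (s - t)\<^sup>2 + (D - d s) / 2) \<longlongrightarrow> 0 + (D - D) / 2) (at t within A)"
    by (rule tendsto_add)
  then show ?thesis
    by (simp, elim Lim_transform_eventually)
       (auto simp: eventually_at_filter R_def field_simps)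
qed

section \<open>Semismoothness of a piecewise smooth function\<close>

context
  fixes f :: "real \<Rightarrow> real" and N v p
  assumes pw: "piecewise_smooth f N v p"
begin

text \<open>The half-open interval around \<open>t\<close> contains a right neighbourhood of
  \<open>t\<close>, on which \<open>f\<close> and the piecewise derivative agree with a single C1
  piece and its derivative.\<close>

lemma piecewise_smooth_slopes_right:
  "((\<lambda>s. (f s - f t) / (s - t)) \<longlongrightarrow> piecewise_deriv N v p t) (at_right t)"
  "(piecewise_deriv N v p \<longlongrightarrow> piecewise_deriv N v p t) (at_right t)"
proof -
  have mono: "strict_mono_on {1..N} v" using pw by (simp add: piecewise_smooth_def)
  obtain k where k: "k \<le> N" "breakpoint N v k \<le> ereal t" "ereal t < breakpoint N v (Suc k)"
    using ex_breakpoint_interval by blast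
  have C1: "p k C1_differentiable_on UNIV" using pw k(1) by (simp add: piecewise_smooth_def)
  have eq: "piecewise_deriv N v p t = deriv (p k) t"
    by (rule piecewise_deriv_eq[OF mono k])
  have ft: "f t = p k t"
    using pw k unfolding piecewise_smooth_def by (metis less_imp_le)
  have ev: "\<forall>\<^sub>F s in at_right t. f s = p k s \<and> piecewise_deriv N v p s = deriv (p k) s"
    using eventually_at_right_less_ereal[OF k(3)] eventually_at_right_less
  proof eventually_elim
    case (elim s)
    then have "breakpoint N v k \<le> ereal s" using k(2) by (meson ereal_less_eq(3) less_imp_le order_trans)
    then show ?case
      using piecewise_deriv_eq[OF mono k(1)] elim(1) pw k(1) unfolding piecewise_smooth_def
      by (metis less_imp_le)
  qed
  show "((\<lambda>s. (f s - f t) / (s - t)) \<longlongrightarrow> piecewise_deriv N v p t) (at_right t)"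
    unfolding eq ft
    by (rule Lim_transform_eventually[OF tendsto_slope_within[OF C1_deriv(1)[OF C1]]])
       (use ev in \<open>auto elim: eventually_mono\<close>)
  have "(deriv (p k) \<longlongrightarrow> deriv (p k) t) (at_right t)"
    using C1_deriv(2)[OF C1] unfolding isCont_def by (rule tendsto_within_subset) simp
  then show "(piecewise_deriv N v p \<longlongrightarrow> piecewise_deriv N v p t) (at_right t)"
    unfolding eq by (rule Lim_transform_eventually) (use ev in \<open>auto elim: eventually_mono\<close>)
qed

text \<open>At a breakpoint the left piece is not the one used by \<open>piecewise_deriv\<close> at
  \<open>t\<close>, so the common limit is left unnamed: it may differ from the value there.\<close>

lemma piecewise_smooth_slopes_left:
  "\<exists>D. ((\<lambda>s. (f s - f t) / (s - t)) \<longlongrightarrow> D) (at_left t) \<and>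
       (piecewise_deriv N v p \<longlongrightarrow> D) (at_left t)"
proof -
  have mono: "strict_mono_on {1..N} v" using pw by (simp add: piecewise_smooth_def)
  obtain k where k: "k \<le> N" "breakpoint N v k < ereal t" "ereal t \<le> breakpoint N v (Suc k)"
    using ex_breakpoint_interval_left by blast
  have C1: "p k C1_differentiable_on UNIV" using pw k(1) by (simp add: piecewise_smooth_def)
  have ft: "f t = p k t"
    using pw k unfolding piecewise_smooth_def by (metis less_imp_le)
  have s_less: "\<forall>\<^sub>F s in at_left t. s < t" by (simp add: eventually_at_filter)
  have ev: "\<forall>\<^sub>F s in at_left t. f s = p k s \<and> piecewise_deriv N v p s = deriv (p k) s"
    using eventually_at_left_greater_ereal[OF k(2)] s_less
  proof eventually_elim
    case (elim s)
    then have "ereal s < breakpoint N v (Suc k)" using k(3) by (meson ereal_less(2) less_ereal.simps(1) less_le_trans)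
    then show ?case
      using piecewise_deriv_eq[OF mono k(1)] elim(1) pw k(1) unfolding piecewise_smooth_def
      by (metis less_imp_le)
  qed
  have "((\<lambda>s. (f s - f t) / (s - t)) \<longlongrightarrow> deriv (p k) t) (at_left t)"
    unfolding ft
    by (rule Lim_transform_eventually[OF tendsto_slope_within[OF C1_deriv(1)[OF C1]]])
       (use ev in \<open>auto elim: eventually_mono\<close>)
  moreover have "(deriv (p k) \<longlongrightarrow> deriv (p k) t) (at_left t)"
    using C1_deriv(2)[OF C1] unfolding isCont_def by (rule tendsto_within_subset) simp
  then have "(piecewise_deriv N v p \<longlongrightarrow> deriv (p k) t) (at_left t)"
    by (rule Lim_transform_eventually) (use ev in \<open>auto elim: eventually_mono\<close>)
  ultimately show ?thesis by blast
qed

text \<open>The two one-sided slopes may disagree, but each is matched by the limit of the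
  derivative from its own side; both remainders vanish, and so does the two-sided one.\<close>

lemma piecewise_smooth_semismooth:
  "((\<lambda>k. (f (t + k) - f t - piecewise_deriv N v p (t + k) * k) / k) \<longlongrightarrow> 0) (at 0)"
proof -
  obtain D where D: "((\<lambda>s. (f s - f t) / (s - t)) \<longlongrightarrow> D) (at_left t)"
      "(piecewise_deriv N v p \<longlongrightarrow> D) (at_left t)"
    using piecewise_smooth_slopes_left by blast
  have "((\<lambda>s. (f s - f t - piecewise_deriv N v p s * (s - t)) / (s - t)) \<longlongrightarrow> 0) (at t)"
    by (rule filterlim_split_at)
       (rule semismooth_quotient[OF D] semismooth_quotient[OF piecewise_smooth_slopes_right])+
  then show ?thesis by (subst (asm) LIM_offset_zero_iff) (auto simp: algebra_simps)
qed

lemma piecewise_smooth_second_order: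
  assumes F: "\<And>s. (F has_real_derivative f s) (at s)"
  shows "((\<lambda>k. (F (t + k) - F t - f t * k - piecewise_deriv N v p (t + k) * k\<^sup>2 / 2) / k\<^sup>2) \<longlongrightarrow> 0) (at 0)"
proof -
  obtain D where D: "((\<lambda>s. (f s - f t) / (s - t)) \<longlongrightarrow> D) (at_left t)"
      "(piecewise_deriv N v p \<longlongrightarrow> D) (at_left t)"
    using piecewise_smooth_slopes_left by blast
  have "((\<lambda>s. (F s - F t - f t * (s - t) - piecewise_deriv N v p s * (s - t)\<^sup>2 / 2) / (s - t)\<^sup>2)
      \<longlongrightarrow> 0) (at t)"
  proof (rule filterlim_split_at)
    show "((\<lambda>s. (F s - F t - f t * (s - t) - piecewise_deriv N v p s * (s - t)\<^sup>2 / 2) / (s - t)\<^sup>2)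
      \<longlongrightarrow> 0) (at_left t)"
      by (rule second_order_quotient[OF F _ D])
         (auto simp: open_segment_eq_real_ivl split: if_splits)
    show "((\<lambda>s. (F s - F t - f t * (s - t) - piecewise_deriv N v p s * (s - t)\<^sup>2 / 2) / (s - t)\<^sup>2)
      \<longlongrightarrow> 0) (at_right t)"
      by (rule second_order_quotient[OF F _ piecewise_smooth_slopes_right])
         (auto simp: open_segment_eq_real_ivl split: if_splits)
  qed
  then show ?thesis by (subst (asm) LIM_offset_zero_iff) (auto simp: algebra_simps)
qed

text \<open>The choice of the right-hand piece makes the function a pointwise limit of difference
  quotients from the right, which avoids working with the definite description.\<close>

lemma borel_measurable_piecewise_deriv:
  assumes [measurable]: "f \<in> borel_measurable borel"
  shows "piecewise_deriv N v p \<in> borel_measurable borel"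
proof (rule borel_measurable_LIMSEQ_real)
  fix t
  have "filterlim (\<lambda>n. t + 1 / real (Suc n)) (at_right t) sequentially"
    by (rule tendsto_imp_filterlim_at_right)
       (use tendsto_add[OF tendsto_const LIMSEQ_Suc[OF lim_1_over_n], of t] in auto)
  with piecewise_smooth_slopes_right(1)[of t]
  show "(\<lambda>n. (f (t + 1 / real (Suc n)) - f t) / (t + 1 / real (Suc n) - t))
      \<longlonglongrightarrow> piecewise_deriv N v p t"
    by (rule filterlim_compose)
qed measurable

lemma piecewise_deriv_bounds:
  assumes "\<And>s t. a \<le> (f s - f t) / (s - t)" "\<And>s t. (f s - f t) / (s - t) \<le> b"
  shows "a \<le> piecewise_deriv N v p t" "piecewise_deriv N v p t \<le> b"
  by (rule tendsto_lowerbound[OF piecewise_smooth_slopes_right(1)]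
           tendsto_upperbound[OF piecewise_smooth_slopes_right(1)], use assms in auto)+

end

section \<open>Operators between a Hilbert space and the space of square integrable functions\<close>

lemma powr_2_abs: "\<bar>x::real\<bar> powr 2 = x\<^sup>2"
  using powr_numeral[of "\<bar>x\<bar>" "num.Bit0 num.One"] by simp

text \<open>The second form is needed because the simplifier rewrites \<open>2\<close> to \<open>ereal 2\<close>.\<close>

lemma Lspace_2_iff:
  "u \<in> Lspace M 2 \<longleftrightarrow> u \<in> borel_measurable M \<and> integrable M (\<lambda>x. (u x)\<^sup>2)"
  "u \<in> Lspace M (ereal 2) \<longleftrightarrow> u \<in> borel_measurable M \<and> integrable M (\<lambda>x. (u x)\<^sup>2)"
  by (simp_all add: Lspace_def powr_2_abs)

lemma Lnorm_2: "Lnorm M 2 u = sqrt (\<integral>x. (u x)\<^sup>2 \<partial>M)"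
  by (simp add: Lnorm_def powr_2_abs powr_half_sqrt)

lemma Lspace_2_bound:
  assumes "w \<in> Lspace M 2" "u \<in> borel_measurable M" "AE x in M. \<bar>u x\<bar> \<le> \<bar>w x\<bar>"
  shows "u \<in> Lspace M 2" "(\<integral>x. (u x)\<^sup>2 \<partial>M) \<le> (\<integral>x. (w x)\<^sup>2 \<partial>M)"
proof -
  have ae: "AE x in M. (u x)\<^sup>2 \<le> (w x)\<^sup>2"
    using assms(3) by eventually_elim (simp add: abs_le_square_iff)
  have int: "integrable M (\<lambda>x. (u x)\<^sup>2)"
    by (rule Bochner_Integration.integrable_bound[of M "\<lambda>x. (w x)\<^sup>2"])
       (use assms ae in \<open>auto simp: Lspace_2_iff\<close>)
  then show "u \<in> Lspace M 2" using assms(2) by (simp add: Lspace_2_iff)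
  show "(\<integral>x. (u x)\<^sup>2 \<partial>M) \<le> (\<integral>x. (w x)\<^sup>2 \<partial>M)"
    by (rule integral_mono_AE[OF int _ ae]) (use assms(1) in \<open>simp add: Lspace_2_iff\<close>)
qed

lemma Lspace_2_integrable_mult:
  assumes "u \<in> Lspace M 2" "w \<in> Lspace M 2"
  shows "integrable M (\<lambda>x. u x * w x)"
proof (rule Bochner_Integration.integrable_bound)
  show "integrable M (\<lambda>x. (u x)\<^sup>2 + (w x)\<^sup>2)"
    by (rule Bochner_Integration.integrable_add)
      (use assms(1)[unfolded Lspace_2_iff] assms(2)[unfolded Lspace_2_iff] in blast)+
  have [measurable]: "u \<in> borel_measurable M" "w \<in> borel_measurable M"
    using assms(1)[unfolded Lspace_2_iff] assms(2)[unfolded Lspace_2_iff] by blast+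
  show "(\<lambda>x. u x * w x) \<in> borel_measurable M" by measurable
  have "\<bar>a * b\<bar> \<le> a\<^sup>2 + b\<^sup>2" for a b :: real
  proof -
    have "2 * \<bar>a\<bar> * \<bar>b\<bar> \<le> a\<^sup>2 + b\<^sup>2" using sum_squares_bound[of "\<bar>a\<bar>" "\<bar>b\<bar>"] by simp
    moreover have "0 \<le> \<bar>a\<bar> * \<bar>b\<bar>" by simp
    ultimately show ?thesis unfolding abs_mult by linarith
  qed
  then show "AE x in M. norm (u x * w x) \<le> norm ((u x)\<^sup>2 + (w x)\<^sup>2)"
    by simp
qed

lemma Lspace_2_cmult: "u \<in> Lspace M 2 \<Longrightarrow> (\<lambda>x. c * u x) \<in> Lspace M 2"
  by (auto simp: Lspace_2_iff power_mult_distrib)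

lemma Lspace_2_add:
  assumes "u \<in> Lspace M 2" "w \<in> Lspace M 2"
  shows "(\<lambda>x. u x + w x) \<in> Lspace M 2"
proof -
  have "integrable M (\<lambda>x. (u x)\<^sup>2 + (w x)\<^sup>2 + 2 * (u x * w x))"
    using assms Lspace_2_integrable_mult[OF assms]
    by (intro Bochner_Integration.integrable_add integrable_mult_right) (auto simp: Lspace_2_iff)
  then show ?thesis
    using assms by (auto simp: Lspace_2_iff(1) power2_sum mult.assoc simp del: numeral_eq_ereal)
qed

lemma Lspace_2_diff:
  assumes "u \<in> Lspace M 2" "w \<in> Lspace M 2"
  shows "(\<lambda>x. u x - w x) \<in> Lspace M 2"
  using Lspace_2_add[OF assms(1) Lspace_2_cmult[OF assms(2), of "-1"]] by simp

lemma Lspace_2_abs: "u \<in> Lspace M 2 \<Longrightarrow> (\<lambda>x. \<bar>u x\<bar>) \<in> Lspace M 2"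
  by (auto simp: Lspace_2_iff)

lemma (in finite_measure) Lspace_2_const: "(\<lambda>_. c) \<in> Lspace M 2"
  by (simp add: Lspace_2_iff)

lemma (in finite_measure) Lspace_2_integrable: "u \<in> Lspace M 2 \<Longrightarrow> integrable M u"
  using Lspace_2_integrable_mult[OF _ Lspace_2_const[of 1], of u] by simp

text \<open>
  No Hoelder inequality is needed: on \<open>\<bar>T h\<bar> > L * norm h\<close> the square is absorbed by the \<open>r\<close>-th
  power, and on the rest dominated convergence applies to \<open>Q\<close> along a subsequence.
\<close>

lemma superposition_remainder:
  fixes T :: "'y::real_normed_vector \<Rightarrow> 'w \<Rightarrow> real" and Q :: "real \<Rightarrow> real \<Rightarrow> real"
  assumes "finite_measure M"
    and r: "r > 2" and K: "K \<ge> 0"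
    and T_meas [measurable]: "\<And>h. T h \<in> borel_measurable M"
    and T_int: "\<And>h. integrable M (\<lambda>x. \<bar>T h x\<bar> powr r)"
    and T_le: "\<And>h. (\<integral>x. \<bar>T h x\<bar> powr r \<partial>M) \<le> K * norm h powr r"
    and w [measurable]: "w \<in> borel_measurable M"
    and Q_meas [measurable]: "case_prod Q \<in> borel_measurable (borel \<Otimes>\<^sub>M borel)"
    and Q_ge: "\<And>t k. 0 \<le> Q t k" and Q_le: "\<And>t k. Q t k \<le> B"
    and Q_lim: "\<And>t. (Q t \<longlongrightarrow> 0) (nhds 0)"
    and e: "e > 0"
  shows "\<forall>\<^sub>F h in at 0. (\<integral>x. (T h x)\<^sup>2 * Q (w x) (T h x) \<partial>M) \<le> e * (norm h)\<^sup>2"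
proof (rule ccontr)
  interpret finite_measure M by fact
  have B: "B \<ge> 0" using Q_ge Q_le order_trans by blast
  assume not_small: "\<not> ?thesis"
  have "\<exists>h. h \<noteq> 0 \<and> norm h < 1 / real (Suc n) \<and>
      e * (norm h)\<^sup>2 < (\<integral>x. (T h x)\<^sup>2 * Q (w x) (T h x) \<partial>M)" for n
  proof (rule ccontr)
    assume "\<not> ?thesis"
    then have "\<forall>h\<in>UNIV. h \<noteq> 0 \<and> dist h 0 < 1 / real (Suc n) \<longrightarrow>
        (\<integral>x. (T h x)\<^sup>2 * Q (w x) (T h x) \<partial>M) \<le> e * (norm h)\<^sup>2"
      unfolding dist_norm diff_zero using not_le by blast
    then have "\<forall>\<^sub>F h in at 0. (\<integral>x. (T h x)\<^sup>2 * Q (w x) (T h x) \<partial>M) \<le> e * (norm h)\<^sup>2"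
      unfolding eventually_at by (intro exI[of _ "1 / real (Suc n)"] conjI) simp_all
    with not_small show False ..
  qed
  then have "\<exists>H. \<forall>n. H n \<noteq> 0 \<and> norm (H n) < 1 / real (Suc n) \<and>
      e * (norm (H n))\<^sup>2 < (\<integral>x. (T (H n) x)\<^sup>2 * Q (w x) (T (H n) x) \<partial>M)"
    by (intro choice allI)
  then obtain H where H: "\<And>n. H n \<noteq> 0" "\<And>n. norm (H n) < 1 / real (Suc n)"
      "\<And>n. e * (norm (H n))\<^sup>2 < (\<integral>x. (T (H n) x)\<^sup>2 * Q (w x) (T (H n) x) \<partial>M)"
    by blast
  have H0: "(\<lambda>n. norm (H n)) \<longlonglongrightarrow> 0"
  proof (rule Lim_null_comparison[OF _ LIMSEQ_Suc[OF lim_1_over_n]], intro always_eventually allI)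
    show "norm (norm (H n)) \<le> 1 / real (Suc n)" for n
      using H(2)[of n] by simp
  qed
  have "(\<lambda>n. K * norm (H n) powr r) \<longlonglongrightarrow> K * 0 powr r"
    using r by (intro tendsto_intros H0) auto
  then have lim: "(\<lambda>n. K * norm (H n) powr r) \<longlonglongrightarrow> 0" using r by simp
  \<comment> \<open>Convergence in the mean yields convergence almost everywhere only along a
    subsequence. Arguing by contradiction makes this enough, since the violation holds along every
    subsequence of \<open>H\<close>.\<close>
  have "(\<lambda>n. \<integral>x. norm (\<bar>T (H n) x\<bar> powr r) \<partial>M) \<longlonglongrightarrow> 0"
    by (rule Lim_null_comparison[OF _ lim]) (use T_le in auto)
  from tendsto_L1_AE_subseq[OF T_int this]
  obtain s :: "nat \<Rightarrow> nat" where s: "strict_mono s"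
      "AE x in M. (\<lambda>n. \<bar>T (H (s n)) x\<bar> powr r) \<longlonglongrightarrow> 0"
    by blast
  have "AE x in M. (\<lambda>n. Q (w x) (T (H (s n)) x)) \<longlonglongrightarrow> 0"
    using s(2)
  proof eventually_elim
    case (elim x)
    have "(\<lambda>n. (\<bar>T (H (s n)) x\<bar> powr r) powr (1 / r)) \<longlonglongrightarrow> 0 powr (1 / r)"
      using r by (intro tendsto_intros elim) auto
    then have "(\<lambda>n. T (H (s n)) x) \<longlonglongrightarrow> 0"
      using r by (simp add: powr_powr tendsto_rabs_zero_iff)
    then show ?case by (rule filterlim_compose[OF Q_lim])
  qed
  then have "(\<lambda>n. \<integral>x. Q (w x) (T (H (s n)) x) \<partial>M) \<longlonglongrightarrow> (\<integral>x. 0 \<partial>M)"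
    by (intro integral_dominated_convergence[where w="\<lambda>_. B"]) (use Q_ge Q_le in auto)
  then have Q0: "(\<lambda>n. \<integral>x. Q (w x) (T (H (s n)) x) \<partial>M) \<longlonglongrightarrow> 0" by simp
  \<comment> \<open>The exponent \<open>2 - r\<close> is negative, so a large cutoff makes the share
    of the large values of \<open>T h\<close> at most half of \<open>e\<close>. \<open>L\<close> is
    fixed before \<open>n\<close>, whose choice then handles the rest.\<close>
  have "((\<lambda>L. L powr (2 - r)) \<longlongrightarrow> 0) at_top"
    by (rule tendsto_neg_powr[OF _ filterlim_ident]) (use r in simp)
  then have "((\<lambda>L. B * K * L powr (2 - r)) \<longlongrightarrow> B * K * 0) at_top"
    by (rule tendsto_mult_left)
  then have "\<forall>\<^sub>F L in at_top. B * K * L powr (2 - r) < e / 2"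
    by (rule order_tendstoD) (use e in simp)
  then have "\<forall>\<^sub>F L in at_top. B * K * L powr (2 - r) < e / 2 \<and> 0 < (L::real)"
    using eventually_gt_at_top by (rule eventually_conj)
  then obtain L where L: "B * K * L powr (2 - r) < e / 2" "0 < L"
    using eventually_happens'[OF trivial_limit_at_top_linorder] by blast
  have "(\<lambda>n. L\<^sup>2 * (\<integral>x. Q (w x) (T (H (s n)) x) \<partial>M)) \<longlonglongrightarrow> L\<^sup>2 * 0"
    by (rule tendsto_mult_left[OF Q0])
  then have "\<forall>\<^sub>F n in sequentially. L\<^sup>2 * (\<integral>x. Q (w x) (T (H (s n)) x) \<partial>M) < e / 2"
    by (rule order_tendstoD) (use e in simp)
  then obtain n where n: "L\<^sup>2 * (\<integral>x. Q (w x) (T (H (s n)) x) \<partial>M) < e / 2"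
    using eventually_happens'[OF sequentially_bot] by blast
  define h where "h = H (s n)"
  define \<rho> where "\<rho> = norm h"
  have \<rho>: "\<rho> > 0" using H(1) by (simp add: \<rho>_def h_def)
  have Q_int: "integrable M (\<lambda>x. Q (w x) (T h x))"
    by (rule integrable_const_bound[of _ B]) (use Q_ge Q_le in auto)
  \<comment> \<open>The cutoff scales with \<rho>, so that both terms have order
    \<open>\<rho>^2\<close> after integration: \<open>\<rho> powr (2 - r)\<close> meets
    \<open>\<rho> powr r\<close> from the moment bound.\<close>
  have pointwise: "k\<^sup>2 * Q t k \<le> (L * \<rho>)\<^sup>2 * Q t k + B * (L * \<rho>) powr (2 - r) * \<bar>k\<bar> powr r" for t k
  proof (cases "\<bar>k\<bar> \<le> L * \<rho>")
    case True
    then have "k\<^sup>2 \<le> (L * \<rho>)\<^sup>2" by (metis abs_ge_zero power2_abs power_mono)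
    then have "k\<^sup>2 * Q t k \<le> (L * \<rho>)\<^sup>2 * Q t k" by (intro mult_right_mono Q_ge)
    then show ?thesis using B by (simp add: add_increasing2)
  next
    case False
    moreover have "0 < L * \<rho>" using L(2) \<rho> by simp
    ultimately have k: "0 < \<bar>k\<bar>" "L * \<rho> < \<bar>k\<bar>" by linarith+
    have "k\<^sup>2 = \<bar>k\<bar> powr (2 - r) * \<bar>k\<bar> powr r"
      by (simp add: powr_add[symmetric] powr_2_abs)
    also have "\<dots> \<le> (L * \<rho>) powr (2 - r) * \<bar>k\<bar> powr r"
      using r k \<open>0 < L * \<rho>\<close> by (intro mult_right_mono powr_mono2') auto
    finally have "k\<^sup>2 * Q t k \<le> ((L * \<rho>) powr (2 - r) * \<bar>k\<bar> powr r) * B"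
      by (intro mult_mono Q_le Q_ge) auto
    then show ?thesis using Q_ge[of t k] by (simp add: mult_ac add_increasing)
  qed
  have "(\<integral>x. (T h x)\<^sup>2 * Q (w x) (T h x) \<partial>M)
      \<le> (\<integral>x. (L * \<rho>)\<^sup>2 * Q (w x) (T h x) + B * (L * \<rho>) powr (2 - r) * \<bar>T h x\<bar> powr r \<partial>M)"
    by (rule integral_mono') (use B Q_ge Q_int T_int pointwise in auto)
  also have "\<dots> = (L * \<rho>)\<^sup>2 * (\<integral>x. Q (w x) (T h x) \<partial>M)
      + B * (L * \<rho>) powr (2 - r) * (\<integral>x. \<bar>T h x\<bar> powr r \<partial>M)"
    using Q_int T_int by simp
  also have "\<dots> \<le> (L * \<rho>)\<^sup>2 * (\<integral>x. Q (w x) (T h x) \<partial>M)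
      + B * (L * \<rho>) powr (2 - r) * (K * \<rho> powr r)"
    unfolding \<rho>_def using B by (intro add_left_mono mult_left_mono T_le) auto
  also have "(L * \<rho>) powr (2 - r) = L powr (2 - r) * \<rho> powr (2 - r)"
    using L(2) \<rho> by (simp add: powr_mult)
  also have "B * (L powr (2 - r) * \<rho> powr (2 - r)) * (K * \<rho> powr r)
      = B * K * L powr (2 - r) * (\<rho> powr (2 - r) * \<rho> powr r)"
    by (simp add: mult_ac)
  also have "\<rho> powr (2 - r) * \<rho> powr r = \<rho>\<^sup>2"
    using \<rho> by (simp add: powr_add[symmetric])
  also have "(L * \<rho>)\<^sup>2 * (\<integral>x. Q (w x) (T h x) \<partial>M) + B * K * L powr (2 - r) * \<rho>\<^sup>2
      = \<rho>\<^sup>2 * (L\<^sup>2 * (\<integral>x. Q (w x) (T h x) \<partial>M) + B * K * L powr (2 - r))"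
    by (simp add: power_mult_distrib algebra_simps)
  also have "\<dots> \<le> \<rho>\<^sup>2 * e"
    using L(1) n unfolding h_def by (intro mult_left_mono) auto
  also have "\<dots> < (\<integral>x. (T h x)\<^sup>2 * Q (w x) (T h x) \<partial>M)"
    using H(3)[of "s n"] by (simp add: h_def \<rho>_def mult.commute)
  finally show False by simp
qed

section \<open>The operator and its adjoint, acting on representatives\<close>

locale L2_operator =
  fixes M :: "'w measure" and S :: "('w \<Rightarrow> real) \<Rightarrow> 'y::real_inner" and T :: "'y \<Rightarrow> 'w \<Rightarrow> real"
  assumes S: "bounded_linear_from_L2 M S" and T: "hilbert_adjoint_L2 M S T"
begin

lemma T_L2: "T y \<in> Lspace M 2"
  using T by (simp add: hilbert_adjoint_L2_def)

lemma T_measurable [measurable]: "T y \<in> borel_measurable M"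
  using T_L2 by (simp add: Lspace_2_iff)

lemma T_square_integrable: "integrable M (\<lambda>x. (T y x)\<^sup>2)"
  using T_L2 by (simp add: Lspace_2_iff)

lemma inner_S: "u \<in> Lspace M 2 \<Longrightarrow> inner (S u) y = (\<integral>x. u x * T y x \<partial>M)"
  using T by (simp add: hilbert_adjoint_L2_def)

lemma S_add: "u \<in> Lspace M 2 \<Longrightarrow> w \<in> Lspace M 2 \<Longrightarrow> S (\<lambda>x. u x + w x) = S u + S w"
  using S by (simp add: bounded_linear_from_L2_def)

lemma S_cmult: "u \<in> Lspace M 2 \<Longrightarrow> S (\<lambda>x. c * u x) = c *\<^sub>R S u"
  using S by (simp add: bounded_linear_from_L2_def)

lemma S_diff: "u \<in> Lspace M 2 \<Longrightarrow> w \<in> Lspace M 2 \<Longrightarrow> S (\<lambda>x. u x - w x) = S u - S w"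
  using S_add[of u "\<lambda>x. -1 * w x"] S_cmult[of w "-1"] Lspace_2_cmult[of w M "-1"] by simp

lemma bound_exists: "\<exists>C\<ge>0. \<forall>u\<in>Lspace M 2. norm (S u) \<le> C * sqrt (\<integral>x. (u x)\<^sup>2 \<partial>M)"
proof -
  obtain C where C: "\<And>u. u \<in> Lspace M 2 \<Longrightarrow> norm (S u) \<le> C * sqrt (\<integral>x. (u x)\<^sup>2 \<partial>M)"
    using S unfolding bounded_linear_from_L2_def Lnorm_2 by blast
  have "norm (S u) \<le> max C 0 * sqrt (\<integral>x. (u x)\<^sup>2 \<partial>M)" if "u \<in> Lspace M 2" for u
    by (rule order_trans[OF C[OF that]]) (simp add: mult_right_mono)
  then show ?thesis by (intro exI[of _ "max C 0"]) auto
qed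

definition bound :: real where
  "bound = (SOME C. C \<ge> 0 \<and> (\<forall>u\<in>Lspace M 2. norm (S u) \<le> C * sqrt (\<integral>x. (u x)\<^sup>2 \<partial>M)))"

lemma bound_nonneg: "bound \<ge> 0"
  and norm_S_le: "u \<in> Lspace M 2 \<Longrightarrow> norm (S u) \<le> bound * sqrt (\<integral>x. (u x)\<^sup>2 \<partial>M)"
  using someI_ex[OF bound_exists] by (auto simp: bound_def)

text \<open>The difference has seminorm 0 and \<open>S\<close> is bounded. This is how identities
  that hold only almost everywhere, such as the additivity of the adjoint, are used inside
  \<open>S\<close>.\<close>

lemma S_cong_AE:
  assumes "u \<in> Lspace M 2" "w \<in> Lspace M 2" "AE x in M. u x = w x"
  shows "S u = S w"
proof -
  have "(\<integral>x. (u x - w x)\<^sup>2 \<partial>M) = (\<integral>x. 0 \<partial>M)"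
    using assms by (intro integral_cong_AE) (auto simp: Lspace_2_iff)
  then have "norm (S (\<lambda>x. u x - w x)) \<le> 0"
    using norm_S_le[OF Lspace_2_diff[OF assms(1,2)]] by simp
  then show ?thesis using S_diff[OF assms(1,2)] by simp
qed

text \<open>The squared seminorm of \<open>T y\<close> equals \<open>inner (S (T y)) y\<close>;
  Cauchy-Schwarz and the bound on \<open>S\<close> allow one factor to be cancelled. The adjoint
  thus inherits the constant of \<open>S\<close>.\<close>

lemma T_norm_le: "sqrt (\<integral>x. (T y x)\<^sup>2 \<partial>M) \<le> bound * norm y"
proof -
  define n where "n = sqrt (\<integral>x. (T y x)\<^sup>2 \<partial>M)"
  have "n * n = inner (S (T y)) y"
    by (simp add: n_def inner_S[OF T_L2] power2_eq_square)
  also have "\<dots> \<le> norm (S (T y)) * norm y"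
    by (rule norm_cauchy_schwarz)
  also have "\<dots> \<le> (bound * n) * norm y"
    unfolding n_def by (intro mult_right_mono norm_S_le T_L2) auto
  finally have "n * n \<le> n * (bound * norm y)" by (simp add: mult_ac)
  moreover have "n \<ge> 0" by (simp add: n_def)
  ultimately have "n \<le> bound * norm y"
    using bound_nonneg by (cases "n = 0") auto
  then show ?thesis by (simp add: n_def)
qed

lemma T_square_le: "(\<integral>x. (T y x)\<^sup>2 \<partial>M) \<le> (bound * norm y)\<^sup>2"
  using power_mono[OF T_norm_le, of y 2] by simp

end

locale L2_Lq_operator = L2_operator M S T + finite_measure M
  for M :: "'w measure" and S :: "('w \<Rightarrow> real) \<Rightarrow> 'y::real_inner" and T :: "'y \<Rightarrow> 'w \<Rightarrow> real" +
  fixes q :: ereal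
  assumes q: "q > 2" and Tq: "bounded_linear_into_L M q T"
begin

lemma T_add: "AE x in M. T (y + z) x = T y x + T z x"
  and T_scale: "AE x in M. T (c *\<^sub>R y) x = c * T y x"
  using Tq by (auto simp: bounded_linear_into_L_def)

text \<open>Reduces all admissible \<open>q\<close> to one finite exponent. A finite
  \<open>q\<close> serves itself; for \<open>q = \<infinity>\<close> the essential bound and the
  finite measure give moments of every order, and 3 is picked as an exponent above 2.\<close>

lemma moment_bound:
  "\<exists>r K. r > 2 \<and> K \<ge> 0 \<and> (\<forall>y. integrable M (\<lambda>x. \<bar>T y x\<bar> powr r)) \<and>
     (\<forall>y. (\<integral>x. \<bar>T y x\<bar> powr r \<partial>M) \<le> K * norm y powr r)"
proof -
  obtain C0 where C0: "\<And>y. Lnorm M q (T y) \<le> C0 * norm y"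
    using Tq unfolding bounded_linear_into_L_def by blast
  define C where "C = max C0 0"
  have C: "C \<ge> 0" "Lnorm M q (T y) \<le> C * norm y" for y
    using order_trans[OF C0 mult_right_mono[of C0 C "norm y"]] by (auto simp: C_def)
  have Lq: "T y \<in> Lspace M q" for y
    using Tq unfolding bounded_linear_into_L_def by blast
  show ?thesis
  proof (cases q)
    case (real r)
    have r: "r > 2" using q real by simp
    have "(\<integral>x. \<bar>T y x\<bar> powr r \<partial>M) \<le> C powr r * norm y powr r" for y
    proof -
      define I where "I = (\<integral>x. \<bar>T y x\<bar> powr r \<partial>M)"
      have "I \<ge> 0" by (simp add: I_def)
      have "I powr (1 / r) \<le> C * norm y"
        using C(2)[of y] by (simp add: Lnorm_def real I_def)
      then have "(I powr (1 / r)) powr r \<le> (C * norm y) powr r"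
        using r by (intro powr_mono2) auto
      then show ?thesis
        using r C(1) \<open>I \<ge> 0\<close> by (simp add: powr_powr powr_mult flip: I_def)
    qed
    moreover have "integrable M (\<lambda>x. \<bar>T y x\<bar> powr r)" for y
      using Lq[of y] by (simp add: Lspace_def real)
    ultimately show ?thesis using r by (intro exI[of _ r] exI[of _ "C powr r"]) auto
  next
    case PInf
    have AE: "AE x in M. \<bar>T y x\<bar> \<le> C * norm y" for y
    proof -
      have fin: "esssup M (\<lambda>x. ereal \<bar>T y x\<bar>) < \<infinity>"
        using Lq[of y] PInf by (simp add: Lspace_def)
      have le: "real_of_ereal (esssup M (\<lambda>x. ereal \<bar>T y x\<bar>)) \<le> C * norm y"
        using C(2)[of y] PInf by (simp add: Lnorm_def)
      have "AE x in M. ereal \<bar>T y x\<bar> \<le> esssup M (\<lambda>x. ereal \<bar>T y x\<bar>)"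
        by (rule esssup_AE)
      then show ?thesis
      proof eventually_elim
        case (elim x)
        \<comment> \<open>The essential supremum may be minus infinity, as over a null space; the
          inequality at \<open>x\<close> is then contradictory.\<close>
        then show ?case using fin le
          by (cases "esssup M (\<lambda>x. ereal \<bar>T y x\<bar>)") auto
      qed
    qed
    have AE3: "AE x in M. \<bar>T y x\<bar> powr 3 \<le> C powr 3 * norm y powr 3" for y
      using AE[of y]
    proof eventually_elim
      case (elim x)
      then have "\<bar>T y x\<bar> powr 3 \<le> (C * norm y) powr 3" by (intro powr_mono2) auto
      then show ?case using C(1) by (simp add: powr_mult)
    qed
    have int: "integrable M (\<lambda>x. \<bar>T y x\<bar> powr 3)" for y
      by (rule integrable_const_bound[of _ "C powr 3 * norm y powr 3"]) (use AE3[of y] in auto)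
    have "(\<integral>x. \<bar>T y x\<bar> powr 3 \<partial>M) \<le> (C powr 3 * measure M (space M)) * norm y powr 3" for y
    proof -
      have "(\<integral>x. \<bar>T y x\<bar> powr 3 \<partial>M) \<le> (\<integral>x. C powr 3 * norm y powr 3 \<partial>M)"
        by (intro integral_mono_AE int AE3) auto
      then show ?thesis by (simp add: mult_ac)
    qed
    with int show ?thesis
      by (intro exI[of _ 3] exI[of _ "C powr 3 * measure M (space M)"]) auto
  next
    case MInf
    with q show ?thesis by simp
  qed
qed

text \<open>Remainder quotients have only a punctured limit, while \<open>T h x\<close> may vanish
  on a large set. The value 0 at 0, supplied in the applications by division by zero, extends the
  limit to a full neighbourhood.\<close>

lemma superposition_remainder_T:
  fixes Q :: "real \<Rightarrow> real \<Rightarrow> real"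
  assumes "a > 0"
    and [measurable]: "w \<in> borel_measurable M"
    and [measurable]: "case_prod Q \<in> borel_measurable (borel \<Otimes>\<^sub>M borel)"
    and "\<And>t k. 0 \<le> Q t k" "\<And>t k. Q t k \<le> B"
    and lim: "\<And>t. (Q t \<longlongrightarrow> 0) (at 0)" and Q0: "\<And>t. Q t 0 = 0"
    and "e > 0"
  shows "\<forall>\<^sub>F h in at 0. (\<integral>x. (T h x)\<^sup>2 * Q (w x) (T h x / a) \<partial>M) \<le> e * (norm h)\<^sup>2"
proof -
  obtain r K where *: "r > 2" "K \<ge> 0" "\<And>y. integrable M (\<lambda>x. \<bar>T y x\<bar> powr r)"
     "\<And>y. (\<integral>x. \<bar>T y x\<bar> powr r \<partial>M) \<le> K * norm y powr r"
    using moment_bound by blast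
  have "isCont (Q t) 0" for t
    using lim[of t] by (simp add: isCont_def Q0)
  then have "(Q t \<longlongrightarrow> 0) (nhds 0)" for t
    using Q0 by (metis isCont_def tendsto_at_iff_tendsto_nhds)
  moreover have "((\<lambda>k. k / a) \<longlongrightarrow> 0) (nhds 0)"
    using tendsto_divide[OF filterlim_ident tendsto_const[of a "nhds 0"]] assms(1) by simp
  ultimately have "((\<lambda>k. Q t (k / a)) \<longlongrightarrow> 0) (nhds 0)" for t
    by (rule filterlim_compose)
  then show ?thesis
    by (intro superposition_remainder[OF finite_measure_axioms * (1,2) T_measurable *(3,4),
          where Q="\<lambda>t k. Q t (k / a)" and B=B]) (use assms in auto)
qed

end

section \<open>The dual function\<close>

lemma ereal_divide_pos:
  assumes "a > 0" "x \<noteq> -\<infinity>"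
  shows "x / ereal a = (if x = \<infinity> then \<infinity> else ereal (real_of_ereal x / a))"
  using assms by (cases x) auto

lemma proper_convex_lsc_divide:
  assumes "a > 0" "proper_on UNIV h" "convex_ext h" "lsc_ext h"
  shows "proper_convex_lsc (\<lambda>t. h t / ereal a)"
proof
  have h: "h t \<noteq> -\<infinity>" for t using assms(2) by (simp add: proper_on_def)
  note div = ereal_divide_pos[OF assms(1) h]
  show "proper_on UNIV (\<lambda>t. h t / ereal a)"
    using assms(2) by (auto simp: proper_on_def div)
  show "convex_ext (\<lambda>t. h t / ereal a)"
    unfolding convex_ext_def
  proof (intro allI ballI)
    fix x y t :: real assume t: "t \<in> {0<..<1}"
    have "h ((1 - t) *\<^sub>R x + t *\<^sub>R y) / ereal a \<le> (ereal (1 - t) * h x + ereal t * h y) / ereal a"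
      using assms(1,3) t by (intro ereal_divide_right_mono) (auto simp: convex_ext_def)
    also have "\<dots> = ereal (1 - t) * (h x / ereal a) + ereal t * (h y / ereal a)"
      using t h[of x] h[of y] assms(1)
      by (cases "h x"; cases "h y") (auto simp: add_divide_distrib)
    finally show "h ((1 - t) *\<^sub>R x + t *\<^sub>R y) / ereal a
        \<le> ereal (1 - t) * (h x / ereal a) + ereal t * (h y / ereal a)" .
  qed
  show "lsc_ext (\<lambda>t. h t / ereal a)"
    unfolding lsc_ext_def
  proof (intro allI impI)
    fix x :: real and X assume "X \<longlonglongrightarrow> x"
    then have "h x \<le> liminf (\<lambda>n. h (X n))" using assms(4) by (simp add: lsc_ext_def)
    then have "h x * ereal (inverse a) \<le> liminf (\<lambda>n. h (X n)) * ereal (inverse a)"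
      using assms(1) by (intro ereal_mult_right_mono) auto
    also have "\<dots> = liminf (\<lambda>n. h (X n) * ereal (inverse a))"
      using assms(1) by (intro Liminf_ereal_mult_right[symmetric]) auto
    finally show "h x / ereal a \<le> liminf (\<lambda>n. h (X n) / ereal a)"
      using assms(1) by (simp add: divide_ereal_def)
  qed
qed

text \<open>A positive factor changes neither finiteness nor integrability. The scaled functional is
  again an integral functional, so the scalar theory of \<open>h / a\<close> applies under the
  integral.\<close>

lemma integral_functional_divide:
  assumes "a > 0" "proper_on UNIV h"
  shows "integral_functional M h u / ereal a = integral_functional M (\<lambda>t. h t / ereal a) u"
proof -
  have h: "h t \<noteq> -\<infinity>" for t using assms(2) by (simp add: proper_on_def)
  note div = ereal_divide_pos[OF assms(1) h]
  have fin: "\<bar>h t / ereal a\<bar> \<noteq> \<infinity> \<longleftrightarrow> \<bar>h t\<bar> \<noteq> \<infinity>" for t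
    using assms(1) h[of t] by (cases "h t") auto
  have real: "real_of_ereal (h t / ereal a) = real_of_ereal (h t) / a" for t
    by (simp add: div)
  have "integrable M (\<lambda>x. real_of_ereal (h (u x)) / a)
      \<longleftrightarrow> integrable M (\<lambda>x. real_of_ereal (h (u x)))"
    using assms(1) integrable_mult_left_iff[where c="inverse a" and M=M and f="\<lambda>x. real_of_ereal (h (u x))"]
    by (simp add: divide_inverse)
  then show ?thesis
    using assms(1) unfolding integral_functional_def fin real by simp
qed

section \<open>Composition of the scalar functions with square integrable functions\<close>

context proper_convex_lsc
begin

lemma potential_abs_le: "\<bar>potential t\<bar> \<le> \<bar>potential 0\<bar> + \<bar>prox h 0\<bar> * \<bar>t\<bar> + t\<^sup>2"
  using potential_remainder[of t 0] by (simp add: abs_mult[symmetric])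

lemma prox_abs_le: "\<bar>prox h t\<bar> \<le> \<bar>prox h 0\<bar> + \<bar>t\<bar>"
  using prox_nonexpansive[of t 0] by simp

lemma integrable_potential:
  assumes "finite_measure M" "u \<in> Lspace M 2"
  shows "integrable M (\<lambda>x. potential (u x))"
proof (rule Bochner_Integration.integrable_bound)
  interpret finite_measure M by fact
  have [measurable]: "u \<in> borel_measurable M" using assms(2) by (simp add: Lspace_2_iff)
  show "integrable M (\<lambda>x. \<bar>potential 0\<bar> + \<bar>prox h 0\<bar> * \<bar>u x\<bar> + (u x)\<^sup>2)"
    using Lspace_2_integrable[OF assms(2)] assms(2)
    by (intro Bochner_Integration.integrable_add integrable_mult_right integrable_abs)
       (auto simp: Lspace_2_iff)
  show "(\<lambda>x. potential (u x)) \<in> borel_measurable M" by measurable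
  show "AE x in M. norm (potential (u x)) \<le> norm (\<bar>potential 0\<bar> + \<bar>prox h 0\<bar> * \<bar>u x\<bar> + (u x)\<^sup>2)"
    using potential_abs_le by (intro always_eventually allI) (auto intro: order_trans[OF _ abs_ge_self])
qed

lemma prox_Lspace_2:
  assumes "finite_measure M" "u \<in> Lspace M 2"
  shows "(\<lambda>x. prox h (u x)) \<in> Lspace M 2"
proof (rule Lspace_2_bound)
  interpret finite_measure M by fact
  show "(\<lambda>x. \<bar>prox h 0\<bar> + \<bar>u x\<bar>) \<in> Lspace M 2"
    using assms(2) by (intro Lspace_2_add Lspace_2_const Lspace_2_abs)
  have [measurable]: "u \<in> borel_measurable M" using assms(2) by (simp add: Lspace_2_iff)
  show "(\<lambda>x. prox h (u x)) \<in> borel_measurable M" by measurable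
  show "AE x in M. \<bar>prox h (u x)\<bar> \<le> \<bar>\<bar>prox h 0\<bar> + \<bar>u x\<bar>\<bar>"
    using prox_abs_le by (intro always_eventually allI) (auto intro: order_trans[OF _ abs_ge_self])
qed

lemma integrable_envelope:
  assumes "finite_measure M" "u \<in> Lspace M 2"
  shows "integrable M (\<lambda>x. envelope (u x))"
proof -
  have "integrable M (\<lambda>x. (u x)\<^sup>2 / 2 - potential (u x))"
    using integrable_potential[OF assms] assms(2) by (auto simp: Lspace_2_iff)
  then show ?thesis by (simp add: potential_def)
qed

text \<open>Minimization and integration commute here. The pointwise minimizer
  \<open>prox h (z x)\<close> is a member of L^2 and attains the value; every competitor with a
  finite integral is compared pointwise through \<open>envelope_le\<close>, and the others have
  value infinity.\<close>

lemma env_L2_integral_functional: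
  assumes M: "finite_measure M" and z: "z \<in> Lspace M 2"
  shows "env_L2 M (integral_functional M h) z = ereal (\<integral>x. envelope (z x) \<partial>M)"
proof (rule antisym)
  have norm: "(Lnorm M 2 (\<lambda>x. u x - z x))\<^sup>2 / 2 = (\<integral>x. (u x - z x)\<^sup>2 / 2 \<partial>M)" for u
    by (simp add: Lnorm_2 del: numeral_eq_ereal)
  have sq: "integrable M (\<lambda>x. (u x - z x)\<^sup>2 / 2)" if "u \<in> Lspace M 2" for u
    using Lspace_2_diff[OF that z] by (auto simp: Lspace_2_iff)
  note P = prox_Lspace_2[OF M z]
  \<comment> \<open>Both measurability and integrability of \<open>h\<close> along the proximal map
    come from writing it as the envelope minus the quadratic term.\<close>
  have "integrable M (\<lambda>x. envelope (z x) - (prox h (z x) - z x)\<^sup>2 / 2)"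
    by (intro Bochner_Integration.integrable_diff integrable_envelope M z sq P)
  then have int: "integrable M (\<lambda>x. real_of_ereal (h (prox h (z x))))"
    by (simp add: envelope_def)
  have fin: "\<bar>h (prox h t)\<bar> \<noteq> \<infinity>" for t
    by (subst prox_finite) simp
  have "ereal ((Lnorm M 2 (\<lambda>x. prox h (z x) - z x))\<^sup>2 / 2)
      + integral_functional M h (\<lambda>x. prox h (z x)) = ereal (\<integral>x. envelope (z x) \<partial>M)"
    unfolding norm integral_functional_def using int fin sq[OF P]
    by (simp add: envelope_def)
  then show "env_L2 M (integral_functional M h) z \<le> ereal (\<integral>x. envelope (z x) \<partial>M)"
    unfolding env_L2_def using P by (intro INF_lower2[OF P]) simp
  show "ereal (\<integral>x. envelope (z x) \<partial>M) \<le> env_L2 M (integral_functional M h) z"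
    unfolding env_L2_def
  proof (rule INF_greatest)
    fix u assume u: "u \<in> Lspace M 2"
    show "ereal (\<integral>x. envelope (z x) \<partial>M)
        \<le> ereal ((Lnorm M 2 (\<lambda>x. u x - z x))\<^sup>2 / 2) + integral_functional M h u"
    proof (cases "(AE x in M. \<bar>h (u x)\<bar> \<noteq> \<infinity>) \<and> integrable M (\<lambda>x. real_of_ereal (h (u x)))")
      case True
      have "(\<integral>x. envelope (z x) \<partial>M) \<le> (\<integral>x. (u x - z x)\<^sup>2 / 2 + real_of_ereal (h (u x)) \<partial>M)"
      proof (rule integral_mono_AE)
        show "AE x in M. envelope (z x) \<le> (u x - z x)\<^sup>2 / 2 + real_of_ereal (h (u x))"
          using True[THEN conjunct1] by eventually_elim (rule envelope_le)
      qed (use True sq[OF u] integrable_envelope[OF M z] in auto)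
      also have "\<dots> = (\<integral>x. (u x - z x)\<^sup>2 / 2 \<partial>M) + (\<integral>x. real_of_ereal (h (u x)) \<partial>M)"
        using True sq[OF u] by (intro Bochner_Integration.integral_add) auto
      finally show ?thesis
        unfolding integral_functional_def if_P[OF True] norm by simp
    next
      case False
      then show ?thesis unfolding integral_functional_def if_not_P[OF False] by simp
    qed
  qed
qed

end

section \<open>The dual function, its gradient and its generalized second derivative\<close>

locale prox_dual = L2_Lq_operator M S T q + proper_convex_lsc h
  for M :: "'w measure" and S :: "('w \<Rightarrow> real) \<Rightarrow> 'y::real_inner" and T q h +
  fixes \<alpha> :: real and N v p
  assumes \<alpha>: "\<alpha> > 0" and pw: "piecewise_smooth (prox h) N v p"
begin

abbreviation d :: "real \<Rightarrow> real" where "d \<equiv> piecewise_deriv N v p"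

text \<open>An integral form of \<open>Psi\<close>: with \<open>z = T y x / \<alpha>\<close>, the
  term \<open>\<alpha> * z^2 / 2\<close> of the scaled potential is the integrand of the quadratic
  part, and the rest is the envelope part.\<close>

definition \<Psi> :: "'y \<Rightarrow> real" where "\<Psi> y = \<alpha> * (\<integral>x. potential (T y x / \<alpha>) \<partial>M)"

definition G :: "'y \<Rightarrow> 'y" where "G y = S (\<lambda>x. prox h (T y x / \<alpha>))"

lemma d_bounds: "0 \<le> d t" "d t \<le> 1"
  using piecewise_deriv_bounds[OF pw prox_slope] by auto

lemma d_measurable [measurable]: "d \<in> borel_measurable borel"
  by (rule borel_measurable_piecewise_deriv[OF pw borel_measurable_prox])

lemma scaled_L2: "(\<lambda>x. T y x / \<alpha>) \<in> Lspace M 2"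
  using Lspace_2_cmult[OF T_L2, of "1 / \<alpha>" y] by simp

lemma prox_L2: "(\<lambda>x. prox h (T y x / \<alpha>)) \<in> Lspace M 2"
  by (rule prox_Lspace_2[OF finite_measure_axioms scaled_L2])

lemma potential_int: "integrable M (\<lambda>x. potential (T y x / \<alpha>))"
  by (rule integrable_potential[OF finite_measure_axioms scaled_L2])

lemma d_mult_L2: "(\<lambda>x. d (T \<xi> x / \<alpha>) * T y x) \<in> Lspace M 2"
  and d_mult_le: "(\<integral>x. (d (T \<xi> x / \<alpha>) * T y x)\<^sup>2 \<partial>M) \<le> (\<integral>x. (T y x)\<^sup>2 \<partial>M)"
proof -
  have meas: "(\<lambda>x. d (T \<xi> x / \<alpha>) * T y x) \<in> borel_measurable M" by measurable
  have le: "AE x in M. \<bar>d (T \<xi> x / \<alpha>) * T y x\<bar> \<le> \<bar>T y x\<bar>"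
    using d_bounds by (intro always_eventually allI) (simp add: abs_mult mult_left_le_one_le)
  show "(\<lambda>x. d (T \<xi> x / \<alpha>) * T y x) \<in> Lspace M 2"
    "(\<integral>x. (d (T \<xi> x / \<alpha>) * T y x)\<^sup>2 \<partial>M) \<le> (\<integral>x. (T y x)\<^sup>2 \<partial>M)"
    by (rule Lspace_2_bound[OF T_L2 meas le])+
qed

definition hess :: "'y \<Rightarrow> 'y \<Rightarrow> 'y" where
  "hess \<xi> y = (1 / \<alpha>) *\<^sub>R S (\<lambda>x. d (T \<xi> x / \<alpha>) * T y x)"

lemma inner_hess: "inner (hess \<xi> y) z = (1 / \<alpha>) * (\<integral>x. d (T \<xi> x / \<alpha>) * T y x * T z x \<partial>M)"
  by (simp add: hess_def inner_S[OF d_mult_L2])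

lemma norm_hess_le: "norm (hess \<xi> y) \<le> bound\<^sup>2 / \<alpha> * norm y"
proof -
  have "norm (S (\<lambda>x. d (T \<xi> x / \<alpha>) * T y x)) \<le> bound * sqrt (\<integral>x. (d (T \<xi> x / \<alpha>) * T y x)\<^sup>2 \<partial>M)"
    by (rule norm_S_le[OF d_mult_L2])
  also have "\<dots> \<le> bound * (bound * norm y)"
    by (intro mult_left_mono order_trans[OF real_sqrt_le_mono[OF d_mult_le] T_norm_le] bound_nonneg)
  finally show ?thesis
    using \<alpha> by (simp add: hess_def power2_eq_square divide_right_mono mult.assoc)
qed

text \<open>Additivity and homogeneity of \<open>T\<close> hold only almost everywhere, so each
  identity is first moved inside \<open>S\<close> through \<open>S_cong_AE\<close>.\<close>

lemma bounded_linear_hess: "bounded_linear (hess \<xi>)"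
proof (rule bounded_linear_intro)
  show "hess \<xi> (y + z) = hess \<xi> y + hess \<xi> z" for y z
  proof -
    have "S (\<lambda>x. d (T \<xi> x / \<alpha>) * T (y + z) x)
        = S (\<lambda>x. d (T \<xi> x / \<alpha>) * T y x + d (T \<xi> x / \<alpha>) * T z x)"
    proof (rule S_cong_AE[OF d_mult_L2 Lspace_2_add[OF d_mult_L2 d_mult_L2]])
      show "AE x in M. d (T \<xi> x / \<alpha>) * T (y + z) x = d (T \<xi> x / \<alpha>) * T y x + d (T \<xi> x / \<alpha>) * T z x"
        using T_add[of y z] by eventually_elim (simp add: distrib_left)
    qed
    then show ?thesis
      by (simp add: hess_def S_add[OF d_mult_L2 d_mult_L2] scaleR_add_right)
  qed
  show "hess \<xi> (c *\<^sub>R y) = c *\<^sub>R hess \<xi> y" for c y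
  proof -
    have "S (\<lambda>x. d (T \<xi> x / \<alpha>) * T (c *\<^sub>R y) x) = S (\<lambda>x. c * (d (T \<xi> x / \<alpha>) * T y x))"
    proof (rule S_cong_AE[OF d_mult_L2 Lspace_2_cmult[OF d_mult_L2]])
      show "AE x in M. d (T \<xi> x / \<alpha>) * T (c *\<^sub>R y) x = c * (d (T \<xi> x / \<alpha>) * T y x)"
        using T_scale[of c y] by eventually_elim simp
    qed
    then show ?thesis by (simp add: hess_def S_cmult[OF d_mult_L2])
  qed
  show "norm (hess \<xi> y) \<le> norm y * (bound\<^sup>2 / \<alpha>)" for y
    using norm_hess_le[of \<xi> y] by (simp add: mult.commute)
qed

text \<open>Boundedness and linearity of \<open>hess \<xi>\<close> make the set nonempty,
  extensionality leaves one element. The suprema in the definition of semismoothness thereby become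
  single terms.\<close>

lemma D2Psi_eq: "D2Psi \<alpha> d S T \<xi> = {Blinfun (hess \<xi>)}"
proof -
  have "A \<in> D2Psi \<alpha> d S T \<xi> \<longleftrightarrow> blinfun_apply A = hess \<xi>" for A
    by (auto simp: D2Psi_def hess_def fun_eq_iff)
  then show ?thesis
    using bounded_linear_Blinfun_apply[OF bounded_linear_hess[of \<xi>]]
    by (auto simp: blinfun_apply_inverse simp flip: blinfun_apply_inject)
qed

lemma apply_hess: "blinfun_apply (Blinfun (hess \<xi>)) = hess \<xi>"
  by (rule bounded_linear_Blinfun_apply[OF bounded_linear_hess])

lemma scaled_square_le: "(\<integral>x. (T y x / \<alpha>)\<^sup>2 \<partial>M) \<le> (bound * norm y)\<^sup>2 / \<alpha>\<^sup>2"
  using T_square_le[of y] \<alpha> by (simp add: power_divide divide_right_mono)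

text \<open>The adjoint identity turns the gradient term into an integral, so the remainder becomes
  an integral of scalar remainders. All pieces are integrable separately, and
  \<open>T (y + k)\<close> is split almost everywhere.\<close>

lemma \<Psi>_first_order:
  "\<Psi> (y + k) - \<Psi> y - inner (G y) k
     = \<alpha> * (\<integral>x. potential (T y x / \<alpha> + T k x / \<alpha>) - potential (T y x / \<alpha>)
                    - prox h (T y x / \<alpha>) * (T k x / \<alpha>) \<partial>M)"
  and integrable_first_order: "integrable M (\<lambda>x. potential (T y x / \<alpha> + T k x / \<alpha>)
     - potential (T y x / \<alpha>) - prox h (T y x / \<alpha>) * (T k x / \<alpha>))"
proof -
  have shift: "(\<integral>x. potential (T (y + k) x / \<alpha>) \<partial>M) = (\<integral>x. potential (T y x / \<alpha> + T k x / \<alpha>) \<partial>M)"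
  proof (rule integral_cong_AE)
    show "AE x in M. potential (T (y + k) x / \<alpha>) = potential (T y x / \<alpha> + T k x / \<alpha>)"
      using T_add[of y k] by eventually_elim (simp add: add_divide_distrib)
  qed measurable
  have int1: "integrable M (\<lambda>x. potential (T y x / \<alpha> + T k x / \<alpha>))"
    by (intro integrable_potential finite_measure_axioms Lspace_2_add scaled_L2)
  have int2: "integrable M (\<lambda>x. prox h (T y x / \<alpha>) * (T k x / \<alpha>))"
    by (rule Lspace_2_integrable_mult[OF prox_L2 scaled_L2])
  show "integrable M (\<lambda>x. potential (T y x / \<alpha> + T k x / \<alpha>)
     - potential (T y x / \<alpha>) - prox h (T y x / \<alpha>) * (T k x / \<alpha>))"
    by (intro Bochner_Integration.integrable_diff int1 int2 potential_int)
  have "inner (G y) k = \<alpha> * (\<integral>x. prox h (T y x / \<alpha>) * (T k x / \<alpha>) \<partial>M)"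
    using \<alpha> by (simp add: G_def inner_S[OF prox_L2])
  then show "\<Psi> (y + k) - \<Psi> y - inner (G y) k
     = \<alpha> * (\<integral>x. potential (T y x / \<alpha> + T k x / \<alpha>) - potential (T y x / \<alpha>)
                    - prox h (T y x / \<alpha>) * (T k x / \<alpha>) \<partial>M)"
    using int1 int2 potential_int unfolding \<Psi>_def shift by (simp add: algebra_simps)
qed

text \<open>The quadratic bound on the scalar remainder integrates to
  \<open>bound^2 / \<alpha>\<close> times the squared norm of the increment.\<close>

lemma GDERIV_\<Psi>: "GDERIV \<Psi> y :> G y"
  unfolding gderiv_def has_derivative_at
proof
  show "bounded_linear (\<lambda>k. inner k (G y))"
    by (rule bounded_linear_inner_left)
  have le: "norm (\<Psi> (y + k) - \<Psi> y - inner k (G y)) \<le> bound\<^sup>2 / \<alpha> * (norm k)\<^sup>2" for k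
  proof -
    let ?f = "\<lambda>x. potential (T y x / \<alpha> + T k x / \<alpha>) - potential (T y x / \<alpha>)
                    - prox h (T y x / \<alpha>) * (T k x / \<alpha>)"
    have "\<bar>\<integral>x. ?f x \<partial>M\<bar> \<le> (\<integral>x. \<bar>?f x\<bar> \<partial>M)"
      by (rule integral_abs_bound)
    also have "\<dots> \<le> (\<integral>x. (T k x / \<alpha>)\<^sup>2 \<partial>M)"
    proof (rule integral_mono)
      show "\<bar>?f x\<bar> \<le> (T k x / \<alpha>)\<^sup>2" for x
        using potential_remainder[of "T y x / \<alpha> + T k x / \<alpha>" "T y x / \<alpha>"] by simp
      show "integrable M (\<lambda>x. (T k x / \<alpha>)\<^sup>2)"
        using scaled_L2 by (simp add: Lspace_2_iff)
    qed (rule integrable_abs[OF integrable_first_order])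
    also have "\<dots> \<le> (bound * norm k)\<^sup>2 / \<alpha>\<^sup>2"
      by (rule scaled_square_le)
    finally have "\<alpha> * \<bar>\<integral>x. ?f x \<partial>M\<bar> \<le> \<alpha> * ((bound * norm k)\<^sup>2 / \<alpha>\<^sup>2)"
      using \<alpha> by (intro mult_left_mono) auto
    then show ?thesis
      using \<alpha> unfolding inner_commute[of k] \<Psi>_first_order
      by (simp add: abs_mult power2_eq_square mult_ac)
  qed
  show "(\<lambda>k. norm (\<Psi> (y + k) - \<Psi> y - inner k (G y)) / norm k) \<midarrow>0\<rightarrow> 0"
  proof (rule Lim_null_comparison[where g = "\<lambda>k. bound\<^sup>2 / \<alpha> * norm k"])
    have "norm (\<Psi> (y + k) - \<Psi> y - inner k (G y)) / norm k \<le> bound\<^sup>2 / \<alpha> * norm k" for k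
      using le[of k] by (cases "k = 0") (auto simp: divide_le_eq power2_eq_square mult_ac)
    then show "\<forall>\<^sub>F k in at 0. norm (norm (\<Psi> (y + k) - \<Psi> y - inner k (G y)) / norm k)
        \<le> bound\<^sup>2 / \<alpha> * norm k"
      by simp
    show "((\<lambda>k. bound\<^sup>2 / \<alpha> * norm k) \<longlongrightarrow> 0) (at (0::'y))"
      by (intro tendsto_eq_intros) auto
  qed
qed

text \<open>Nonexpansiveness of the scalar proximal map carries over to L^2; one factor
  \<open>bound\<close> in the Lipschitz constant comes from \<open>S\<close>, the other from its
  adjoint.\<close>

lemma continuous_on_G: "continuous_on UNIV G"
proof (rule lipschitz_on_continuous_on)
  show "(bound * (bound / \<alpha>))-lipschitz_on UNIV G"
  proof (rule lipschitz_onI)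
    fix y z :: 'y
    have "norm (G y - G z) = norm (S (\<lambda>x. prox h (T y x / \<alpha>) - prox h (T z x / \<alpha>)))"
      by (simp add: G_def S_diff[OF prox_L2 prox_L2])
    also have "\<dots> \<le> bound * sqrt (\<integral>x. (prox h (T y x / \<alpha>) - prox h (T z x / \<alpha>))\<^sup>2 \<partial>M)"
      by (rule norm_S_le[OF Lspace_2_diff[OF prox_L2 prox_L2]])
    also have "\<dots> \<le> bound * sqrt ((bound * norm (y - z))\<^sup>2 / \<alpha>\<^sup>2)"
    proof (intro mult_left_mono real_sqrt_le_mono order_trans[OF Lspace_2_bound(2) scaled_square_le])
      show "AE x in M. \<bar>prox h (T y x / \<alpha>) - prox h (T z x / \<alpha>)\<bar> \<le> \<bar>T (y - z) x / \<alpha>\<bar>"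
        using T_add[of "y - z" z]
      proof eventually_elim
        case (elim x)
        then have "T (y - z) x / \<alpha> = T y x / \<alpha> - T z x / \<alpha>"
          by (simp add: add_divide_distrib)
        then show ?case using prox_nonexpansive[of "T y x / \<alpha>" "T z x / \<alpha>"] by simp
      qed
    qed (use scaled_L2 bound_nonneg in auto)
    also have "\<dots> = bound * (bound / \<alpha>) * norm (y - z)"
      using bound_nonneg \<alpha> by (simp add: real_sqrt_divide)
    finally show "dist (G y) (G z) \<le> bound * (bound / \<alpha>) * dist y z"
      by (simp add: dist_norm)
  qed (use bound_nonneg \<alpha> in auto)
qed

text \<open>The integrand is the square of \<open>T k x / \<alpha>\<close> times the scalar quotient
  \<open>Q\<close>, up to sign. \<open>Q\<close> is bounded and tends to 0 pointwise, which is what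
  the superposition estimate asks for.\<close>

lemma second_order_remainder:
  assumes e: "e > 0"
  shows "\<forall>\<^sub>F k in at 0. \<bar>\<Psi> (y + k) - \<Psi> y - inner (G y) k - inner (hess (y + k) k) k / 2\<bar>
    \<le> e * (norm k)\<^sup>2"
proof -
  define R where "R t s = potential (t + s) - potential t - prox h t * s - d (t + s) * s\<^sup>2 / 2" for t s
  define Q where "Q t s = \<bar>R t s / s\<^sup>2\<bar>" for t s
  have R_meas: "(\<lambda>(t, s). R t s) \<in> borel_measurable (borel \<Otimes>\<^sub>M borel)"
    unfolding R_def by measurable
  then have Q_meas: "case_prod Q \<in> borel_measurable (borel \<Otimes>\<^sub>M borel)"
    unfolding Q_def by measurable
  have R_le: "\<bar>R t s\<bar> \<le> 2 * s\<^sup>2" for t s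
  proof -
    have "\<bar>potential (t + s) - potential t - prox h t * s\<bar> \<le> s\<^sup>2"
      using potential_remainder[of "t + s" t] by simp
    moreover have "0 \<le> d (t + s) * s\<^sup>2" "d (t + s) * s\<^sup>2 \<le> s\<^sup>2"
      using d_bounds[of "t + s"] by (simp_all add: mult_left_le_one_le)
    ultimately show ?thesis unfolding R_def by linarith
  qed
  \<comment> \<open>The factor \<open>\<alpha>\<close> in the tolerance offsets the
    \<open>1 / \<alpha>\<close> that remains when the outer \<open>\<alpha>\<close> meets the square
    of \<open>T k x / \<alpha>\<close>.\<close>
  have "\<forall>\<^sub>F k in at 0. (\<integral>x. (T k x)\<^sup>2 * Q (T y x / \<alpha>) (T k x / \<alpha>) \<partial>M) \<le> (e * \<alpha>) * (norm k)\<^sup>2"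
  proof (rule superposition_remainder_T[OF \<alpha>, where Q = Q and B = 2 and w = "\<lambda>x. T y x / \<alpha>"])
    show "Q t s \<le> 2" for t s
      using R_le[of t s] by (cases "s = 0") (simp_all add: Q_def abs_divide divide_le_eq)
    have "((\<lambda>s. R t s / s\<^sup>2) \<longlongrightarrow> 0) (at 0)" for t
      unfolding R_def by (rule piecewise_smooth_second_order[OF pw potential_has_derivative])
    then show "(Q t \<longlongrightarrow> 0) (at 0)" for t
      unfolding Q_def by (rule tendsto_rabs_zero)
  qed (use e \<alpha> Q_meas in \<open>auto simp: Q_def\<close>)
  then show ?thesis
  proof eventually_elim
    case (elim k)
    have RQ: "\<bar>R t s\<bar> = s\<^sup>2 * Q t s" for t s
      using R_le[of t s] by (cases "s = 0") (simp_all add: Q_def abs_divide)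
    have hess: "inner (hess (y + k) k) k / 2
        = \<alpha> * (\<integral>x. d (T y x / \<alpha> + T k x / \<alpha>) * (T k x / \<alpha>)\<^sup>2 / 2 \<partial>M)"
    proof -
      have "(\<integral>x. d (T (y + k) x / \<alpha>) * T k x * T k x \<partial>M)
          = (\<integral>x. \<alpha>\<^sup>2 * 2 * (d (T y x / \<alpha> + T k x / \<alpha>) * (T k x / \<alpha>)\<^sup>2 / 2) \<partial>M)"
      proof (rule integral_cong_AE)
        show "AE x in M. d (T (y + k) x / \<alpha>) * T k x * T k x
            = \<alpha>\<^sup>2 * 2 * (d (T y x / \<alpha> + T k x / \<alpha>) * (T k x / \<alpha>)\<^sup>2 / 2)"
          using T_add[of y k]
          by eventually_elim (use \<alpha> in \<open>simp add: add_divide_distrib power2_eq_square\<close>)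
      qed measurable
      then show ?thesis
        using \<alpha> by (simp only: inner_hess integral_mult_right_zero) (simp add: power2_eq_square)
    qed
    have int: "integrable M (\<lambda>x. d (T y x / \<alpha> + T k x / \<alpha>) * (T k x / \<alpha>)\<^sup>2 / 2)"
    proof (rule Bochner_Integration.integrable_bound)
      show "integrable M (\<lambda>x. (T k x / \<alpha>)\<^sup>2)" using scaled_L2 by (simp add: Lspace_2_iff)
      have "\<bar>d t * s\<^sup>2 / 2\<bar> \<le> s\<^sup>2" for t s
      proof -
        have "0 \<le> d t * s\<^sup>2" "d t * s\<^sup>2 \<le> s\<^sup>2"
          using d_bounds[of t] by (simp_all add: mult_left_le_one_le)
        then show ?thesis by linarith
      qed
      then show "AE x in M. norm (d (T y x / \<alpha> + T k x / \<alpha>) * (T k x / \<alpha>)\<^sup>2 / 2)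
          \<le> norm ((T k x / \<alpha>)\<^sup>2)" by simp
    qed measurable
    have "\<Psi> (y + k) - \<Psi> y - inner (G y) k - inner (hess (y + k) k) k / 2
        = \<alpha> * (\<integral>x. R (T y x / \<alpha>) (T k x / \<alpha>) \<partial>M)"
      unfolding \<Psi>_first_order hess R_def
      using integrable_first_order[of y k] int
      by (subst Bochner_Integration.integral_diff[OF integrable_first_order[of y k] int])
         (simp add: right_diff_distrib)
    also have "\<bar>\<dots>\<bar> = \<alpha> * \<bar>\<integral>x. R (T y x / \<alpha>) (T k x / \<alpha>) \<partial>M\<bar>"
      using \<alpha> by (simp add: abs_mult)
    also have "\<dots> \<le> \<alpha> * (\<integral>x. \<bar>R (T y x / \<alpha>) (T k x / \<alpha>)\<bar> \<partial>M)"
      using \<alpha> by (intro mult_left_mono integral_abs_bound) auto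
    also have "\<dots> = 1 / \<alpha> * (\<integral>x. (T k x)\<^sup>2 * Q (T y x / \<alpha>) (T k x / \<alpha>) \<partial>M)"
      using \<alpha> by (simp add: RQ power_divide power2_eq_square)
    also have "\<dots> \<le> 1 / \<alpha> * ((e * \<alpha>) * (norm k)\<^sup>2)"
      using \<alpha> elim by (intro mult_left_mono) auto
    finally show ?case using \<alpha> by simp
  qed
qed

text \<open>Boundedness of \<open>S\<close> reduces the claim to the L^2 norm of the scalar
  remainder, whose square is \<open>s^2\<close> times the squared semismoothness quotient. Hence the
  same superposition estimate applies, with the bound 4 as the square of 2.\<close>

lemma gradient_remainder:
  assumes e: "e > 0"
  shows "\<forall>\<^sub>F k in at 0. norm (G (y + k) - G y - hess (y + k) k) \<le> e * norm k"
proof -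
  define R where "R t s = prox h (t + s) - prox h t - d (t + s) * s" for t s
  define Q where "Q t s = (R t s / s)\<^sup>2" for t s
  have R_meas: "(\<lambda>(t, s). R t s) \<in> borel_measurable (borel \<Otimes>\<^sub>M borel)"
    unfolding R_def by measurable
  then have Q_meas: "case_prod Q \<in> borel_measurable (borel \<Otimes>\<^sub>M borel)"
    unfolding Q_def by measurable
  have R_le: "\<bar>R t s\<bar> \<le> 2 * \<bar>s\<bar>" for t s
  proof -
    have "\<bar>prox h (t + s) - prox h t\<bar> \<le> \<bar>s\<bar>"
      using prox_nonexpansive[of "t + s" t] by simp
    moreover have "\<bar>d (t + s) * s\<bar> \<le> \<bar>s\<bar>"
      using d_bounds[of "t + s"] by (simp add: abs_mult mult_left_le_one_le)
    ultimately show ?thesis unfolding R_def by linarith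
  qed
  \<comment> \<open>Chosen so that \<open>bound * c / \<alpha> \<le> e\<close>; the added 1 keeps
    the denominator positive when \<open>bound\<close> is 0.\<close>
  define c where "c = e * \<alpha> / (bound + 1)"
  have c: "c > 0" "bound * c \<le> e * \<alpha>"
    using e \<alpha> bound_nonneg by (auto simp: c_def divide_le_eq)
  have "\<forall>\<^sub>F k in at 0. (\<integral>x. (T k x)\<^sup>2 * Q (T y x / \<alpha>) (T k x / \<alpha>) \<partial>M) \<le> c\<^sup>2 * (norm k)\<^sup>2"
  proof (rule superposition_remainder_T[OF \<alpha>, where Q = Q and B = 4 and w = "\<lambda>x. T y x / \<alpha>"])
    show "Q t s \<le> 4" for t s
    proof -
      have "\<bar>R t s / s\<bar> \<le> 2"
        using R_le[of t s] by (cases "s = 0") (simp_all add: abs_divide divide_le_eq)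
      then show ?thesis
        using power_mono[of "\<bar>R t s / s\<bar>" 2 2] unfolding Q_def power2_abs by simp
    qed
    have "((\<lambda>s. R t s / s) \<longlongrightarrow> 0) (at 0)" for t
      unfolding R_def by (rule piecewise_smooth_semismooth[OF pw])
    then show "(Q t \<longlongrightarrow> 0) (at 0)" for t
      using tendsto_power[of "\<lambda>s. R t s / s" 0 "at 0" 2] unfolding Q_def by simp
  qed (use c Q_meas in \<open>auto simp: Q_def\<close>)
  then show ?thesis
  proof eventually_elim
    case (elim k)
    have R_meas': "(\<lambda>x. R (T y x / \<alpha>) (T k x / \<alpha>)) \<in> borel_measurable M"
      unfolding R_def by measurable
    have "\<bar>R t s\<bar> \<le> \<bar>2 * s\<bar>" for t s
      using R_le[of t s] by simp
    then have "AE x in M. \<bar>R (T y x / \<alpha>) (T k x / \<alpha>)\<bar> \<le> \<bar>2 * (T k x / \<alpha>)\<bar>"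
      by (intro always_eventually allI)
    then have R_L2: "(\<lambda>x. R (T y x / \<alpha>) (T k x / \<alpha>)) \<in> Lspace M 2"
      by (rule Lspace_2_bound(1)[OF Lspace_2_cmult[OF scaled_L2] R_meas'])
    let ?D = "\<lambda>x. 1 / \<alpha> * (d (T (y + k) x / \<alpha>) * T k x)"
    let ?F = "\<lambda>x. prox h (T (y + k) x / \<alpha>) - prox h (T y x / \<alpha>)"
    have D: "?D \<in> Lspace M 2" by (rule Lspace_2_cmult[OF d_mult_L2])
    have F: "?F \<in> Lspace M 2" by (rule Lspace_2_diff[OF prox_L2 prox_L2])
    have "S ?F = G (y + k) - G y"
      by (simp add: G_def S_diff[OF prox_L2 prox_L2])
    moreover have "S ?D = hess (y + k) k"
      unfolding hess_def by (rule S_cmult[OF d_mult_L2])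
    ultimately have "G (y + k) - G y - hess (y + k) k = S (\<lambda>x. ?F x - ?D x)"
      using S_diff[OF F D] by simp
    also have "\<dots> = S (\<lambda>x. R (T y x / \<alpha>) (T k x / \<alpha>))"
    proof (rule S_cong_AE[OF Lspace_2_diff[OF F D] R_L2])
      show "AE x in M. ?F x - ?D x = R (T y x / \<alpha>) (T k x / \<alpha>)"
        using T_add[of y k] by eventually_elim (simp add: R_def add_divide_distrib)
    qed
    finally have "norm (G (y + k) - G y - hess (y + k) k)
        \<le> bound * sqrt (\<integral>x. (R (T y x / \<alpha>) (T k x / \<alpha>))\<^sup>2 \<partial>M)"
      using norm_S_le[OF R_L2] by simp
    \<comment> \<open>At \<open>s = 0\<close> the right side is 0, and \<open>R_le\<close> gives
      \<open>R t 0 = 0\<close>, so the identity has no exception.\<close>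
    also have "(R t s)\<^sup>2 = s\<^sup>2 * Q t s" for t s
      using R_le[of t s] by (cases "s = 0") (simp_all add: Q_def power_divide)
    then have "(\<integral>x. (R (T y x / \<alpha>) (T k x / \<alpha>))\<^sup>2 \<partial>M)
        = 1 / \<alpha>\<^sup>2 * (\<integral>x. (T k x)\<^sup>2 * Q (T y x / \<alpha>) (T k x / \<alpha>) \<partial>M)"
      by (simp add: power_divide)
    also have "bound * sqrt (1 / \<alpha>\<^sup>2 * (\<integral>x. (T k x)\<^sup>2 * Q (T y x / \<alpha>) (T k x / \<alpha>) \<partial>M))
        \<le> bound * sqrt (1 / \<alpha>\<^sup>2 * (c\<^sup>2 * (norm k)\<^sup>2))"
      using bound_nonneg elim by (intro mult_left_mono real_sqrt_le_mono) auto
    also have "\<dots> = bound * c / \<alpha> * norm k"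
      using c(1) \<alpha> by (simp add: real_sqrt_mult real_sqrt_divide)
    also have "\<dots> \<le> e * norm k"
      using c(2) \<alpha> by (intro mult_right_mono) (simp_all add: divide_le_eq)
    finally show ?case .
  qed
qed

lemma second_order_semismooth_\<Psi>: "second_order_semismooth \<Psi> (D2Psi \<alpha> d S T)"
  unfolding second_order_semismooth_def D2Psi_eq
  using GDERIV_\<Psi> continuous_on_G second_order_remainder gradient_remainder
  by (auto simp: apply_hess intro!: exI[of _ G])

end

theorem lemma6p5:
  fixes M :: "'w measure"
    and \<alpha> :: real
    and gt :: "real \<Rightarrow> ereal"
    and g :: "('w \<Rightarrow> real) \<Rightarrow> ereal"
    and N :: nat and v :: "nat \<Rightarrow> real" and p :: "nat \<Rightarrow> real \<Rightarrow> real"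
    and S :: "('w \<Rightarrow> real) \<Rightarrow> 'y::{real_inner,complete_space}"
    and Sadj :: "'y \<Rightarrow> 'w \<Rightarrow> real"
    and q :: ereal
    and dprox :: "real \<Rightarrow> real"
  assumes "finite_measure M"
    and "\<alpha> > 0"
    and "proper_on UNIV gt" and "convex_ext gt" and "lsc_ext gt"
    and g_def: "g = integral_functional M gt"
    and "proper_on (Lspace M 2) g" and "convex_ext_L2 M g" and "lsc_ext_L2 M g"
    and "g (\<lambda>_. 0) < \<infinity>"
    and "piecewise_smooth (prox (\<lambda>t. gt t / ereal \<alpha>)) N v p"
    and dprox_def: "dprox = piecewise_deriv N v p"
    and "bounded_linear_from_L2 M S"
    and "hilbert_adjoint_L2 M S Sadj"
    and "q > 2" and "bounded_linear_into_L M q Sadj"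
  shows "second_order_semismooth (Psi M \<alpha> g Sadj) (D2Psi \<alpha> dprox S Sadj) \<and>
         (\<forall>\<xi>. (\<lambda>x. dprox (Sadj \<xi> x / \<alpha>)) \<in> Lspace M \<infinity>) \<and>
         (\<forall>\<xi>. \<forall>A\<in>D2Psi \<alpha> dprox S Sadj \<xi>.
           (\<forall>y z. inner (blinfun_apply A y) z = inner y (blinfun_apply A z)) \<and>
           (\<forall>y. inner (blinfun_apply A y) y \<ge> 0)) \<and>
         (\<exists>c>0. \<forall>\<xi>. \<forall>A\<in>D2Psi \<alpha> dprox S Sadj \<xi>. norm A \<le> c)"
proof -
  interpret proper_convex_lsc "\<lambda>t. gt t / ereal \<alpha>"
    by (rule proper_convex_lsc_divide) fact+
  interpret finite_measure M by fact
  interpret prox_dual M S Sadj q "\<lambda>t. gt t / ereal \<alpha>" \<alpha> N v p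
    by unfold_locales fact+
  have "Psi M \<alpha> g Sadj \<xi> = \<Psi> \<xi>" for \<xi>
  proof -
    have "env_L2 M (\<lambda>u. g u / ereal \<alpha>) (\<lambda>x. Sadj \<xi> x / \<alpha>)
        = ereal (\<integral>x. envelope (Sadj \<xi> x / \<alpha>) \<partial>M)"
      unfolding g_def integral_functional_divide[OF assms(2,3)]
      by (rule env_L2_integral_functional[OF finite_measure_axioms scaled_L2])
    \<comment> \<open>The outer \<open>\<alpha>\<close> and the square of
      \<open>1 / \<alpha>\<close> combine to the coefficient \<open>1 / (2 * \<alpha>)\<close>; the
      integral may be split because both parts are integrable.\<close>
    moreover have "\<Psi> \<xi> = 1 / (2 * \<alpha>) * (\<integral>x. (Sadj \<xi> x)\<^sup>2 \<partial>M)
        - \<alpha> * (\<integral>x. envelope (Sadj \<xi> x / \<alpha>) \<partial>M)"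
      using T_square_integrable[of \<xi>] integrable_envelope[OF finite_measure_axioms scaled_L2, of \<xi>] \<alpha>
      by (simp add: \<Psi>_def potential_def power_divide right_diff_distrib power2_eq_square)
    ultimately show ?thesis
      by (simp add: Psi_def Lnorm_2 del: numeral_eq_ereal)
  qed
  then have "Psi M \<alpha> g Sadj = \<Psi>" by (rule ext)
  with second_order_semismooth_\<Psi>
  have 1: "second_order_semismooth (Psi M \<alpha> g Sadj) (D2Psi \<alpha> dprox S Sadj)"
    by (simp add: dprox_def)
  have 2: "(\<lambda>x. dprox (Sadj \<xi> x / \<alpha>)) \<in> Lspace M \<infinity>" for \<xi>
  proof -
    have "esssup M (\<lambda>x. ereal \<bar>d (Sadj \<xi> x / \<alpha>)\<bar>) \<le> 1"
      using d_bounds by (intro esssup_I) auto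
    then have "esssup M (\<lambda>x. ereal \<bar>d (Sadj \<xi> x / \<alpha>)\<bar>) < \<infinity>"
      by (rule le_less_trans) simp
    then show ?thesis
      unfolding dprox_def Lspace_def by simp
  qed
  have 3: "inner (hess \<xi> y) z = inner y (hess \<xi> z)" for \<xi> y z
    unfolding inner_commute[of y] inner_hess by (simp add: mult_ac)
  have "0 \<le> d t * s * s" for t s
    using mult_nonneg_nonneg[OF d_bounds(1) zero_le_square] by (simp add: mult.assoc)
  then have 4: "inner (hess \<xi> y) y \<ge> 0" for \<xi> y
    unfolding inner_hess using \<alpha> by (intro mult_nonneg_nonneg[OF _ Bochner_Integration.integral_nonneg]) auto
  \<comment> \<open>The added 1 makes the uniform constant strictly positive even when
    \<open>bound\<close> is 0.\<close>
  have 5: "norm (Blinfun (hess \<xi>)) \<le> bound\<^sup>2 / \<alpha> + 1" for \<xi>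
  proof (rule norm_blinfun_bound)
    show "norm (blinfun_apply (Blinfun (hess \<xi>)) y) \<le> (bound\<^sup>2 / \<alpha> + 1) * norm y" for y
      unfolding apply_hess by (rule order_trans[OF norm_hess_le]) (simp add: distrib_right)
  qed (use \<alpha> in simp)
  have "bound\<^sup>2 / \<alpha> + 1 > 0"
    using \<alpha> by (simp add: add_nonneg_pos)
  with 5 have "\<exists>c>0. \<forall>\<xi>. \<forall>A\<in>D2Psi \<alpha> dprox S Sadj \<xi>. norm A \<le> c"
    unfolding dprox_def D2Psi_eq by blast
  with 1 2 3 4 show ?thesis
    unfolding dprox_def D2Psi_eq by (simp add: apply_hess)
qed

end
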